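(* Let $\mathbb K$ be a field, $s,d\in\mathbb N$, and let $\mathcal R$ be a nc Fornasini--Marchesini realization centred at $\underline Y\in(\mathbb K^{s\times s})^d$ that is described by $(L;D,C,\underline{\mathbf A},\underline{\mathbf B})$. If the coefficients of $\mathcal R$ satisfy the linearized lost-abbey conditions, then $\Omega(\mathcal R)=\coprod_{m\ge1}\Omega_{sm}(\mathcal R)$ is an upper admissible nc subset of $(\mathbb K^d)_{nc}$, with $\underline Y\in\Omega_s(\mathcal R)$, and the function $\mathcal R:\Omega(\mathcal R)\to\mathbb K_{nc}$ given by $$\mathcal R(\underline X)=I_m\otimes D+(I_m\otimes C)\Lambda_{\underline{\mathbf A},\underline Y}(\underline X)^{-1}\sum_{k=1}^d(X_k-I_m\otimes Y_k)\mathbf B_k,\qquad \underline X\in\Omega_{sm}(\mathcal R),\ m\in\mathbb N,$$ is a nc function (its domain is empty at levels $n$ with $s\nmid n$).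
   Context: Realizations. A nc Fornasini--Marchesini realization $\mathcal R$ centred at $\underline Y=(Y_1,\ldots,Y_d)\in(\mathbb K^{s\times s})^d$, described by $(L;D,C,\underline{\mathbf A},\underline{\mathbf B})$, consists of $L\in\mathbb N$, linear maps $\mathbf A_k:\mathbb K^{s\times s}\to\mathbb K^{L\times L}$, $\mathbf B_k:\mathbb K^{s\times s}\to\mathbb K^{L\times s}$ ($1\le k\le d$), and matrices $C\in\mathbb K^{s\times L}$, $D\in\mathbb K^{s\times s}$. A linear map $\mathbf T$ on $\mathbb K^{s\times s}$ is extended to $X=[X_{ij}]\in\mathbb K^{sm\times sm}$ with $s\times s$ blocks by $(X)\mathbf T=[\mathbf T(X_{ij})]$. For $\underline X\in(\mathbb K^{sm\times sm})^d$ put $\Lambda_{\underline{\mathbf A},\underline Y}(\underline X)=I_{Lm}-\sum_k(X_k-I_m\otimes Y_k)\mathbf A_k$ and $\Omega_{sm}(\mathcal R)=\{\underline X\in(\mathbb K^{sm\times sm})^d:\det\Lambda_{\underline{\mathbf A},\underline Y}(\underline X)\ne0\}$. $\otimes$ is the Kronecker product $P\otimes Q=[p_{ij}Q]$. Linearized lost-abbey conditions: with $[S,Y]=SY-YS$, for all $S,Z_1,Z_2\in\mathbb K^{s\times s}$ and $1\le i_1,i_2\le d$: $SD-DS=C\sum_k\mathbf B_k([S,Y_k])$; $SC\mathbf B_{i_1}(Z_1)-C\mathbf B_{i_1}(SZ_1)=C\big(\sum_k\mathbf A_k([S,Y_k])\big)\mathbf B_{i_1}(Z_1)$; $SC\mathbf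 A_{i_1}(Z_1)-C\mathbf A_{i_1}(SZ_1)=C\big(\sum_k\mathbf A_k([S,Y_k])\big)\mathbf A_{i_1}(Z_1)$; $\mathbf B_{i_1}(Z_1S)-\mathbf B_{i_1}(Z_1)S=\mathbf A_{i_1}(Z_1)\sum_k\mathbf B_k([S,Y_k])$; $\mathbf A_{i_1}(Z_1S)\mathbf B_{i_2}(Z_2)-\mathbf A_{i_1}(Z_1)\mathbf B_{i_2}(SZ_2)=\mathbf A_{i_1}(Z_1)\big(\sum_k\mathbf A_k([S,Y_k])\big)\mathbf B_{i_2}(Z_2)$; $\mathbf A_{i_1}(Z_1S)\mathbf A_{i_2}(Z_2)-\mathbf A_{i_1}(Z_1)\mathbf A_{i_2}(SZ_2)=\mathbf A_{i_1}(Z_1)\big(\sum_k\mathbf A_k([S,Y_k])\big)\mathbf A_{i_2}(Z_2)$ (sums over $k=1,\ldots,d$). Nc sets and functions. $(\mathbb K^d)_{nc}=\coprod_n(\mathbb K^{n\times n})^d$, $\mathbb K_{nc}=\coprod_n\mathbb K^{n\times n}$. A subset $\Omega\subseteq(\mathbb K^d)_{nc}$ is a nc set if it is closed under direct sums; it is upper admissible if for all $\underline X\in\Omega_n$, $\underline X'\in\Omega_m$ and $\underline Z\in(\mathbb K^{n\times m})^d$ there is $0\ne c\in\mathbb K$ with $\begin{bmatrix}\underline X&c\underline Z\\0&\underline X'\end{bmatrix}\in\Omega_{n+m}$ (block matrices of tuples are formed coordinatewise). $f:\Omega\to\mathbb K_{nc}$ is a nc function if it is graded ($f(\Omega_n)\subseteq\mathbb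 K^{n\times n}$), $f(\underline X\oplus\underline X')=f(\underline X)\oplus f(\underline X')$, and $f(T\underline XT^{-1})=Tf(\underline X)T^{-1}$ whenever $\underline X,T\underline XT^{-1}\in\Omega_n$, $T\in\mathbb K^{n\times n}$ invertible. *)

theory Defs
  imports "Jordan_Normal_Form.Determinant" "Jordan_Normal_Form.Gauss_Jordan_Elimination"
begin

text \<open>
  Matrices of varying size are those of Jordan_Normal_Form; all indices (rows, columns, blocks and
  the coordinates of a $d$-tuple) start at 0. The notation \<open>four_block_mat P Q R S\<close> is the matrix
  with rows of blocks \<open>P Q\<close> and \<open>R S\<close>.
\<close>


section \<open>Matrix preliminaries\<close>

definition mat_sum :: "nat \<Rightarrow> nat \<Rightarrow> nat \<Rightarrow> (nat \<Rightarrow> 'a::field mat) \<Rightarrow> 'a mat" where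
  "mat_sum p q d M = mat p q (\<lambda>(i, j). \<Sum>k<d. M k $$ (i, j))"

text \<open>Only meaningful for invertible matrices: \<open>mat_inverse\<close> returns \<open>None\<close> on singular ones.\<close>
definition mat_inv :: "'a::field mat \<Rightarrow> 'a mat" where
  "mat_inv M = the (mat_inverse M)"

definition kron :: "'a::field mat \<Rightarrow> 'a mat \<Rightarrow> 'a mat" where
  "kron P Q = mat (dim_row P * dim_row Q) (dim_col P * dim_col Q)
     (\<lambda>(i, j). P $$ (i div dim_row Q, j div dim_col Q) * Q $$ (i mod dim_row Q, j mod dim_col Q))"

definition mat_linear ::
    "nat \<Rightarrow> nat \<Rightarrow> nat \<Rightarrow> nat \<Rightarrow> ('a::field mat \<Rightarrow> 'a mat) \<Rightarrow> bool" where
  "mat_linear n m p q F \<longleftrightarrow>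
     (\<forall>X\<in>carrier_mat n m. F X \<in> carrier_mat p q) \<and>
     (\<forall>X\<in>carrier_mat n m. \<forall>Y\<in>carrier_mat n m. F (X + Y) = F X + F Y) \<and>
     (\<forall>c. \<forall>X\<in>carrier_mat n m. F (c \<cdot>\<^sub>m X) = c \<cdot>\<^sub>m F X)"

definition block :: "nat \<Rightarrow> 'a mat \<Rightarrow> nat \<Rightarrow> nat \<Rightarrow> 'a mat" where
  "block s X i j = mat s s (\<lambda>(a, b). X $$ (i * s + a, j * s + b))"

text \<open>
  The extension \<open>(X)T = [T(X\<^sub>i\<^sub>j)]\<close> of a map \<open>T\<close> from \<open>s \<times> s\<close> to \<open>p \<times> q\<close> matrices to
  a matrix \<open>X\<close> made of \<open>s \<times> s\<close> blocks.
\<close>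
definition blockwise ::
    "nat \<Rightarrow> nat \<Rightarrow> nat \<Rightarrow> ('a mat \<Rightarrow> 'a mat) \<Rightarrow> 'a mat \<Rightarrow> 'a mat" where
  "blockwise s p q T X = mat (p * (dim_row X div s)) (q * (dim_col X div s))
     (\<lambda>(i, j). T (block s X (i div p) (j div q)) $$ (i mod p, j mod q))"

definition commutator :: "'a::field mat \<Rightarrow> 'a mat \<Rightarrow> 'a mat" where
  "commutator S Y = S * Y - Y * S"


section \<open>Nc sets and nc functions\<close>

definition mat_tuples :: "nat \<Rightarrow> nat \<Rightarrow> nat \<Rightarrow> 'a mat list set" where
  "mat_tuples d n m = {X. length X = d \<and> set X \<subseteq> carrier_mat n m}"

text \<open>For \<open>d \<ge> 1\<close> the levels are pairwise disjoint, so the union below is the coproduct.\<close>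
definition nc_space :: "nat \<Rightarrow> 'a mat list set" where
  "nc_space d = (\<Union>n\<in>{1..}. mat_tuples d n n)"

definition nc_level :: "nat \<Rightarrow> 'a mat list set \<Rightarrow> nat \<Rightarrow> 'a mat list set" where
  "nc_level d \<Omega> n = \<Omega> \<inter> mat_tuples d n n"

definition direct_sum :: "'a::field mat \<Rightarrow> 'a mat \<Rightarrow> 'a mat" where
  "direct_sum X X' = four_block_mat X (0\<^sub>m (dim_row X) (dim_col X'))
                                    (0\<^sub>m (dim_row X') (dim_col X)) X'"

definition tuple_direct_sum :: "'a::field mat list \<Rightarrow> 'a mat list \<Rightarrow> 'a mat list" where
  "tuple_direct_sum = map2 direct_sum"

definition tuple_upper ::
    "'a::field mat list \<Rightarrow> 'a \<Rightarrow> 'a mat list \<Rightarrow> 'a mat list \<Rightarrow> 'a mat list" where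
  "tuple_upper X c Z X' = map (\<lambda>k. four_block_mat (X ! k) (c \<cdot>\<^sub>m (Z ! k))
     (0\<^sub>m (dim_row (X' ! k)) (dim_col (X ! k))) (X' ! k)) [0..<length X]"

definition tuple_conj :: "'a::field mat \<Rightarrow> 'a mat list \<Rightarrow> 'a mat list" where
  "tuple_conj T X = map (\<lambda>M. T * M * mat_inv T) X"

definition nc_set :: "nat \<Rightarrow> 'a::field mat list set \<Rightarrow> bool" where
  "nc_set d \<Omega> \<longleftrightarrow> \<Omega> \<subseteq> nc_space d \<and> (\<forall>X\<in>\<Omega>. \<forall>X'\<in>\<Omega>. tuple_direct_sum X X' \<in> \<Omega>)"

definition upper_admissible :: "nat \<Rightarrow> 'a::field mat list set \<Rightarrow> bool" where
  "upper_admissible d \<Omega> \<longleftrightarrow>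
     (\<forall>n m. \<forall>X\<in>nc_level d \<Omega> n. \<forall>X'\<in>nc_level d \<Omega> m. \<forall>Z\<in>mat_tuples d n m.
        \<exists>c. c \<noteq> 0 \<and> tuple_upper X c Z X' \<in> nc_level d \<Omega> (n + m))"

definition nc_function ::
    "nat \<Rightarrow> 'a::field mat list set \<Rightarrow> ('a mat list \<Rightarrow> 'a mat) \<Rightarrow> bool" where
  "nc_function d \<Omega> f \<longleftrightarrow>
     (\<forall>n. \<forall>X\<in>nc_level d \<Omega> n. f X \<in> carrier_mat n n) \<and>
     (\<forall>X\<in>\<Omega>. \<forall>X'\<in>\<Omega>. f (tuple_direct_sum X X') = direct_sum (f X) (f X')) \<and>
     (\<forall>n. \<forall>X\<in>nc_level d \<Omega> n. \<forall>T\<in>carrier_mat n n.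
        invertible_mat T \<longrightarrow> tuple_conj T X \<in> nc_level d \<Omega> n \<longrightarrow>
        f (tuple_conj T X) = T * f X * mat_inv T)"


section \<open>Fornasini--Marchesini realizations\<close>

definition fm_realization ::
    "nat \<Rightarrow> nat \<Rightarrow> nat \<Rightarrow> 'a::field mat \<Rightarrow> 'a mat \<Rightarrow> (nat \<Rightarrow> 'a mat \<Rightarrow> 'a mat) \<Rightarrow>
     (nat \<Rightarrow> 'a mat \<Rightarrow> 'a mat) \<Rightarrow> 'a mat list \<Rightarrow> bool" where
  "fm_realization s d L D C A B Y \<longleftrightarrow>
     Y \<in> mat_tuples d s s \<and> D \<in> carrier_mat s s \<and> C \<in> carrier_mat s L \<and>
     (\<forall>k<d. mat_linear s s L L (A k)) \<and> (\<forall>k<d. mat_linear s s L s (B k))"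

definition fm_Lambda ::
    "nat \<Rightarrow> nat \<Rightarrow> nat \<Rightarrow> (nat \<Rightarrow> 'a::field mat \<Rightarrow> 'a mat) \<Rightarrow> 'a mat list \<Rightarrow>
     nat \<Rightarrow> 'a mat list \<Rightarrow> 'a mat" where
  "fm_Lambda s d L A Y m X = 1\<^sub>m (L * m) -
     mat_sum (L * m) (L * m) d (\<lambda>k. blockwise s L L (A k) (X ! k - kron (1\<^sub>m m) (Y ! k)))"

text \<open>The set \<open>\<Omega>\<^sub>s\<^sub>m(\<R>)\<close>, indexed by \<open>m\<close>.\<close>
definition fm_domain_at ::
    "nat \<Rightarrow> nat \<Rightarrow> nat \<Rightarrow> (nat \<Rightarrow> 'a::field mat \<Rightarrow> 'a mat) \<Rightarrow> 'a mat list \<Rightarrow>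
     nat \<Rightarrow> 'a mat list set" where
  "fm_domain_at s d L A Y m =
     {X \<in> mat_tuples d (s * m) (s * m). det (fm_Lambda s d L A Y m X) \<noteq> 0}"

definition fm_domain ::
    "nat \<Rightarrow> nat \<Rightarrow> nat \<Rightarrow> (nat \<Rightarrow> 'a::field mat \<Rightarrow> 'a mat) \<Rightarrow> 'a mat list \<Rightarrow>
     'a mat list set" where
  "fm_domain s d L A Y = (\<Union>m\<in>{1..}. fm_domain_at s d L A Y m)"

text \<open>For \<open>X \<in> fm_domain_at s d L A Y m\<close> the number \<open>m\<close> is recovered from the size of \<open>X\<close>.\<close>
definition fm_function ::
    "nat \<Rightarrow> nat \<Rightarrow> nat \<Rightarrow> 'a::field mat \<Rightarrow> 'a mat \<Rightarrow> (nat \<Rightarrow> 'a mat \<Rightarrow> 'a mat) \<Rightarrow>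
     (nat \<Rightarrow> 'a mat \<Rightarrow> 'a mat) \<Rightarrow> 'a mat list \<Rightarrow> 'a mat list \<Rightarrow> 'a mat" where
  "fm_function s d L D C A B Y X =
     (let m = dim_row (X ! 0) div s in
        kron (1\<^sub>m m) D +
        kron (1\<^sub>m m) C * mat_inv (fm_Lambda s d L A Y m X) *
          mat_sum (L * m) (s * m) d (\<lambda>k. blockwise s L s (B k) (X ! k - kron (1\<^sub>m m) (Y ! k))))"

definition linearized_lost_abbey ::
    "nat \<Rightarrow> nat \<Rightarrow> nat \<Rightarrow> 'a::field mat \<Rightarrow> 'a mat \<Rightarrow> (nat \<Rightarrow> 'a mat \<Rightarrow> 'a mat) \<Rightarrow>
     (nat \<Rightarrow> 'a mat \<Rightarrow> 'a mat) \<Rightarrow> 'a mat list \<Rightarrow> bool" where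
  "linearized_lost_abbey s d L D C A B Y \<longleftrightarrow>
     (\<forall>S\<in>carrier_mat s s. \<forall>Z1\<in>carrier_mat s s. \<forall>Z2\<in>carrier_mat s s. \<forall>i1<d. \<forall>i2<d.
       (let P = mat_sum L L d (\<lambda>k. A k (commutator S (Y ! k)));
            Q = mat_sum L s d (\<lambda>k. B k (commutator S (Y ! k)))
        in
         S * D - D * S = C * Q \<and>
         S * C * B i1 Z1 - C * B i1 (S * Z1) = C * P * B i1 Z1 \<and>
         S * C * A i1 Z1 - C * A i1 (S * Z1) = C * P * A i1 Z1 \<and>
         B i1 (Z1 * S) - B i1 Z1 * S = A i1 Z1 * Q \<and>
         A i1 (Z1 * S) * B i2 Z2 - A i1 Z1 * B i2 (S * Z2) = A i1 Z1 * P * B i2 Z2 \<and>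
         A i1 (Z1 * S) * A i2 Z2 - A i1 Z1 * A i2 (S * Z2) = A i1 Z1 * P * A i2 Z2))"

end

(* The linearized lost-abbey conditions are identities between s x s blocks; summed over blocks they become
   the same identities for an arbitrary sm x sm matrix T in place of S and I_m (x) Y_k in place of Y_k.
   For the transfer function f and T X = X' T, they give T f(X) = f(X') T by pure algebra, because the matrix R with
   T (I (x) C) (1 - a)^-1 b = (I (x) C) R can be written down explicitly. Invariance under similarity is the
   case of invertible T. At a block upper triangular point Lambda is block upper triangular, so its
   determinant factors and c = 1 always works in upper admissibility. *)
theory Submission
  imports Defs
begin

section \<open>Sums, linear maps and blocks\<close>

text \<open>The conditions speak of P(S) = \<Sum>A_k([S, Y_k]) only between a left factor C or
  A_i(Z) and a right factor A_j(Z') or B_j(Z'). The proof therefore does not look for a matrix that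
  intertwines \<Lambda>(X) with \<Lambda>(X'); it transports only C G with G = (1 - a)^-1 b. Reading
  G as b + a G exposes a right factor a or b on which the conditions can act, and the R found in
  this way solves the resolvent equation at X'. The conditions come in two shapes: G(Z S) = G(Z) S +
  H(Z) Q(S), and H(Z S) G(Z') = H(Z) (G(S Z') + P(S) G(Z')). Replacing the constants C and D by the
  maps Z -> Z C and Z -> Z D brings all six under these shapes, so two block extension arguments are
  enough. Both rest on additivity: a block of a product is a sum of products of blocks.\<close>

lemma mat_sum_carrier [simp]: "mat_sum p q d M \<in> carrier_mat p q"
  by (simp add: mat_sum_def)

lemma mat_sum_index [simp]:
  "i < p \<Longrightarrow> j < q \<Longrightarrow> mat_sum p q d M $$ (i, j) = (\<Sum>k<d. M k $$ (i, j))"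
  by (simp add: mat_sum_def)

lemma mat_sum_dim [simp]: "dim_row (mat_sum p q d M) = p" "dim_col (mat_sum p q d M) = q"
  by (simp_all add: mat_sum_def)

lemma mat_sum_cong: "(\<And>k. k < d \<Longrightarrow> M k = N k) \<Longrightarrow> mat_sum p q d M = mat_sum p q d N"
  by (intro eq_matI) auto

lemma mat_sum_add:
  assumes "\<And>k. k < d \<Longrightarrow> M k \<in> carrier_mat p q" "\<And>k. k < d \<Longrightarrow> N k \<in> carrier_mat p q"
  shows "mat_sum p q d (\<lambda>k. M k + N k) = mat_sum p q d M + mat_sum p q d N"
  using carrier_matD[OF assms(1)] carrier_matD[OF assms(2)]
  by (intro eq_matI) (auto simp: sum.distrib[symmetric] intro!: sum.cong)

lemma mat_sum_swap:
  "mat_sum p q d (\<lambda>k. mat_sum p q e (M k)) = mat_sum p q e (\<lambda>l. mat_sum p q d (\<lambda>k. M k l))"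
  by (intro eq_matI) (auto intro: sum.swap)

lemma mat_sum_mult_left:
  assumes "M \<in> carrier_mat p q" "\<And>k. k < d \<Longrightarrow> N k \<in> carrier_mat q r"
  shows "M * mat_sum q r d N = mat_sum p r d (\<lambda>k. M * N k)"
  using assms(1) carrier_matD[OF assms(2)]
  by (intro eq_matI) (auto simp: scalar_prod_def sum_distrib_left intro: sum.swap)

lemma mat_sum_mult_right:
  assumes "\<And>k. k < d \<Longrightarrow> M k \<in> carrier_mat p q" "N \<in> carrier_mat q r"
  shows "mat_sum p q d M * N = mat_sum p r d (\<lambda>k. M k * N)"
  using assms(2) carrier_matD[OF assms(1)]
  by (intro eq_matI) (auto simp: scalar_prod_def sum_distrib_right intro: sum.swap)

text \<open>Collapses the block sums in which a factor I \<otimes> M leaves a single term.\<close>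

lemma mat_sum_delta:
  assumes "M \<in> carrier_mat p q" "l < d"
  shows "mat_sum p q d (\<lambda>k. if k = l then M else 0\<^sub>m p q) = M"
  using assms by (intro eq_matI) (auto simp: if_distribR if_distrib[of "\<lambda>M. M $$ _"] cong: if_cong)

lemma mat_linear_carrier: "mat_linear n m p q F \<Longrightarrow> X \<in> carrier_mat n m \<Longrightarrow> F X \<in> carrier_mat p q"
  and mat_linear_add: "mat_linear n m p q F \<Longrightarrow> X \<in> carrier_mat n m \<Longrightarrow> X' \<in> carrier_mat n m \<Longrightarrow>
    F (X + X') = F X + F X'"
  by (auto simp: mat_linear_def)

lemma mat_linear_zero:
  assumes "mat_linear n m p q F" shows "F (0\<^sub>m n m) = 0\<^sub>m p q"
proof -
  have "F (0 \<cdot>\<^sub>m 0\<^sub>m n m) = 0 \<cdot>\<^sub>m F (0\<^sub>m n m)" "F (0\<^sub>m n m) \<in> carrier_mat p q"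
    using assms zero_carrier_mat[of n m] unfolding mat_linear_def by blast+
  moreover have "0 \<cdot>\<^sub>m M = 0\<^sub>m p q" if "M \<in> carrier_mat p q" for M :: "'a mat"
    using that by (intro eq_matI) auto
  moreover have "0 \<cdot>\<^sub>m 0\<^sub>m n m = (0\<^sub>m n m :: 'a mat)" by (intro eq_matI) auto
  ultimately show ?thesis by metis
qed

lemma mat_linear_mat_sum:
  assumes F: "mat_linear n m p q F" and "\<And>k. k < d \<Longrightarrow> M k \<in> carrier_mat n m"
  shows "F (mat_sum n m d M) = mat_sum p q d (\<lambda>k. F (M k))"
  using assms(2)
proof (induction d)
  case 0
  have "mat_sum n m 0 M = 0\<^sub>m n m" "mat_sum p q 0 (\<lambda>k. F (M k)) = 0\<^sub>m p q"
    by (auto intro!: eq_matI)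
  then show ?case using mat_linear_zero[OF F] by simp
next
  case (Suc d)
  have Suc_sum: "mat_sum p q (Suc d) N = mat_sum p q d N + N d" if "N d \<in> carrier_mat p q"
    for p q and N :: "nat \<Rightarrow> 'a mat"
    using that by (intro eq_matI) auto
  show ?case
    using Suc by (simp add: Suc_sum mat_linear_add[OF F] mat_linear_carrier[OF F])
qed

text \<open>Rectangular version of \<open>block\<close>, with \<open>blk s s\<close> in the role of
  \<open>block s\<close>: the extensions of A_k and B_k have blocks of shape L x L and L x s, so
  rows and columns need separate block sizes.\<close>

definition blk :: "nat \<Rightarrow> nat \<Rightarrow> 'a mat \<Rightarrow> nat \<Rightarrow> nat \<Rightarrow> 'a mat" where
  "blk p q X i j = mat p q (\<lambda>(a, b). X $$ (i * p + a, j * q + b))"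

lemma blk_carrier [simp]: "blk p q X i j \<in> carrier_mat p q"
  by (simp add: blk_def)

lemma blk_dim [simp]: "dim_row (blk p q X i j) = p" "dim_col (blk p q X i j) = q"
  by (simp_all add: blk_def)

lemma blk_index [simp]:
  "a < p \<Longrightarrow> b < q \<Longrightarrow> blk p q X i j $$ (a, b) = X $$ (i * p + a, j * q + b)"
  by (simp add: blk_def)

lemma block_index_less: "i < m \<Longrightarrow> a < p \<Longrightarrow> i * p + a < p * (m :: nat)"
proof -
  assume "i < m" "a < p"
  then have "i * p + a < Suc i * p" by simp
  also have "\<dots> \<le> m * p" using \<open>i < m\<close> by (intro mult_le_mono1) simp
  finally show ?thesis by (simp add: mult.commute)
qed

lemma eq_blkI:
  assumes "X \<in> carrier_mat (p * m) (q * n)" "X' \<in> carrier_mat (p * m) (q * n)"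
    and eq: "\<And>i j. i < m \<Longrightarrow> j < n \<Longrightarrow> blk p q X i j = blk p q X' i j"
  shows "X = X'"
proof (intro eq_matI)
  fix i j assume "i < dim_row X'" "j < dim_col X'"
  then have ij: "i < p * m" "j < q * n" using assms by auto
  \<comment> \<open>An entry exists, so p and q are positive here and division by them makes sense;
    in general a block size may be 0, as L may be.\<close>
  then have pq: "0 < p" "0 < q" by (auto intro: gr0I)
  have "i div p < m" "j div q < n" using ij by (simp_all add: less_mult_imp_div_less mult.commute)
  from eq[OF this] have "blk p q X (i div p) (j div q) $$ (i mod p, j mod q)
    = blk p q X' (i div p) (j div q) $$ (i mod p, j mod q)" by simp
  then show "X $$ (i, j) = X' $$ (i, j)" using pq by simp
qed (use assms in auto)

lemma blk_add:
  assumes "X \<in> carrier_mat (p * m) (q * n)" "X' \<in> carrier_mat (p * m) (q * n)" "i < m" "j < n"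
  shows "blk p q (X + X') i j = blk p q X i j + blk p q X' i j"
  using assms block_index_less by (intro eq_matI) auto

lemma blk_minus:
  assumes "X \<in> carrier_mat (p * m) (q * n)" "X' \<in> carrier_mat (p * m) (q * n)" "i < m" "j < n"
  shows "blk p q (X - X') i j = blk p q X i j - blk p q X' i j"
  using assms block_index_less by (intro eq_matI) auto

lemma blk_mat_sum:
  assumes "i < m" "j < n"
  shows "blk p q (mat_sum (p * m) (q * n) d M) i j = mat_sum p q d (\<lambda>k. blk p q (M k) i j)"
  using assms block_index_less by (intro eq_matI) auto

lemma blk_mult:
  assumes "X \<in> carrier_mat (p * m) (q * n)" "X' \<in> carrier_mat (q * n) (r * l)" "i < m" "j < l"
  shows "blk p r (X * X') i j = mat_sum p r n (\<lambda>k. blk p q X i k * blk q r X' k j)"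
proof (intro eq_matI)
  fix a b assume "a < dim_row (mat_sum p r n (\<lambda>k. blk p q X i k * blk q r X' k j))"
    "b < dim_col (mat_sum p r n (\<lambda>k. blk p q X i k * blk q r X' k j))"
  then have ab: "a < p" "b < r" by auto
  let ?f = "\<lambda>c. X $$ (i * p + a, c) * X' $$ (c, j * r + b)"
  have "blk p r (X * X') i j $$ (a, b) = sum ?f {..<q * n}"
    using assms ab by (auto simp: block_index_less scalar_prod_def lessThan_atLeast0)
  \<comment> \<open>The inner index of the matrix product is cut into n consecutive intervals of
    length q, one for each block.\<close>
  also have "\<dots> = (\<Sum>k<n. sum ?f {k * q..<k * q + q})"
    by (simp only: sum.nat_group mult.commute[of q])
  also have "\<dots> = (\<Sum>k<n. \<Sum>c = 0..<q. ?f (k * q + c))"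
  proof (rule sum.cong[OF refl])
    fix k
    show "sum ?f {k * q..<k * q + q} = (\<Sum>c = 0..<q. ?f (k * q + c))"
      using sum.shift_bounds_nat_ivl[of ?f 0 "k * q" q] by (simp add: add.commute)
  qed
  finally show "blk p r (X * X') i j $$ (a, b)
      = mat_sum p r n (\<lambda>k. blk p q X i k * blk q r X' k j) $$ (a, b)"
    using ab by (simp add: scalar_prod_def)
qed auto

lemma kron_one_carrier [simp]: "M \<in> carrier_mat p q \<Longrightarrow> kron (1\<^sub>m m) M \<in> carrier_mat (p * m) (q * m)"
  by (auto simp: kron_def)

lemma blk_kron_one:
  assumes "M \<in> carrier_mat p q" "i < m" "j < m"
  shows "blk p q (kron (1\<^sub>m m) M) i j = (if i = j then M else 0\<^sub>m p q)"
  using assms block_index_less[of i m _ p] block_index_less[of j m _ q]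
  by (intro eq_matI) (auto simp: kron_def mult.commute[of m])

lemma blk_mult_kron_one:
  assumes X: "X \<in> carrier_mat (p * m) (q * n)" and M: "M \<in> carrier_mat q r"
    and ij: "i < m" "j < n"
  shows "blk p r (X * kron (1\<^sub>m n) M) i j = blk p q X i j * M"
proof -
  have "blk p r (X * kron (1\<^sub>m n) M) i j
    = mat_sum p r n (\<lambda>k. blk p q X i k * blk q r (kron (1\<^sub>m n) M) k j)"
    using X M ij by (intro blk_mult) simp_all
  also have "\<dots> = mat_sum p r n (\<lambda>k. if k = j then blk p q X i j * M else 0\<^sub>m p r)"
    using M ij by (intro mat_sum_cong) (simp add: blk_kron_one right_mult_zero_mat[OF blk_carrier])
  also have "\<dots> = blk p q X i j * M"
    by (rule mat_sum_delta[OF mult_carrier_mat[OF blk_carrier M] ij(2)])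
  finally show ?thesis .
qed

lemma blk_kron_one_mult:
  assumes X: "X \<in> carrier_mat (q * m) (r * n)" and M: "M \<in> carrier_mat p q"
    and ij: "i < m" "j < n"
  shows "blk p r (kron (1\<^sub>m m) M * X) i j = M * blk q r X i j"
proof -
  have "blk p r (kron (1\<^sub>m m) M * X) i j
    = mat_sum p r m (\<lambda>k. blk p q (kron (1\<^sub>m m) M) i k * blk q r X k j)"
    using X M ij by (intro blk_mult) simp_all
  also have "\<dots> = mat_sum p r m (\<lambda>k. if k = i then M * blk q r X i j else 0\<^sub>m p r)"
    using M ij by (intro mat_sum_cong) (simp add: blk_kron_one left_mult_zero_mat[OF blk_carrier])
  also have "\<dots> = M * blk q r X i j"
    by (rule mat_sum_delta[OF mult_carrier_mat[OF M blk_carrier] ij(1)])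
  finally show ?thesis .
qed

section \<open>Block extension of a linear map\<close>

lemma blockwise_carrier:
  "s \<ge> 1 \<Longrightarrow> X \<in> carrier_mat (s * m) (s * n) \<Longrightarrow> blockwise s p q F X \<in> carrier_mat (p * m) (q * n)"
  by (auto simp: blockwise_def)

text \<open>The working form of the extension: the div and mod of its entrywise definition are dealt
  with here once and for all, and later arguments see only blocks.\<close>

lemma blk_blockwise:
  assumes "s \<ge> 1" "X \<in> carrier_mat (s * m) (s * n)" "mat_linear s s p q F" "i < m" "j < n"
  shows "blk p q (blockwise s p q F X) i j = F (blk s s X i j)"
proof -
  let ?F = "blk p q (blockwise s p q F X) i j"
  have block: "block s X i j = blk s s X i j"
    by (simp add: block_def blk_def)
  have dims: "dim_row X div s = m" "dim_col X div s = n"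
    using assms(1,2) by auto
  show "?F = F (blk s s X i j)"
  proof (intro eq_matI)
    fix a b assume "a < dim_row (F (blk s s X i j))" "b < dim_col (F (blk s s X i j))"
    then have ab: "a < p" "b < q"
      using mat_linear_carrier[OF assms(3) blk_carrier, of X i j] by auto
    show "?F $$ (a, b) = F (blk s s X i j) $$ (a, b)"
      using ab block_index_less[OF assms(4) ab(1)] block_index_less[OF assms(5) ab(2)]
      by (simp add: blockwise_def dims block)
  qed (use mat_linear_carrier[OF assms(3) blk_carrier, of X i j] in auto)
qed

lemma blockwise_add:
  assumes s: "s \<ge> 1" and X: "X \<in> carrier_mat (s * m) (s * n)"
    and X': "X' \<in> carrier_mat (s * m) (s * n)" and F: "mat_linear s s p q F"
  shows "blockwise s p q F (X + X') = blockwise s p q F X + blockwise s p q F X'"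
proof (rule eq_blkI[of _ p m q n])
  have XX': "X + X' \<in> carrier_mat (s * m) (s * n)" using X X' by simp
  note bc = blockwise_carrier[OF s]
  show "blockwise s p q F (X + X') \<in> carrier_mat (p * m) (q * n)" by (rule bc[OF XX'])
  show "blockwise s p q F X + blockwise s p q F X' \<in> carrier_mat (p * m) (q * n)"
    by (rule add_carrier_mat[OF bc[OF X']])
  fix i j assume ij: "i < m" "j < n"
  show "blk p q (blockwise s p q F (X + X')) i j = blk p q (blockwise s p q F X + blockwise s p q F X') i j"
    by (simp add: blk_blockwise[OF s XX' F ij] blk_add[OF bc[OF X] bc[OF X'] ij] blk_add[OF X X' ij]
        blk_blockwise[OF s X F ij] blk_blockwise[OF s X' F ij] mat_linear_add[OF F])
qed

text \<open>The cuts of the partition lie at p * m rows and q * n columns, on block borders, so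
  every p x q block falls inside one of the four corners.\<close>

lemma blk_four_block_mat:
  assumes "X11 \<in> carrier_mat (p * m) (q * n)" "X12 \<in> carrier_mat (p * m) (q * n')"
    "X21 \<in> carrier_mat (p * m') (q * n)" "X22 \<in> carrier_mat (p * m') (q * n')"
    "i < m + m'" "j < n + n'"
  shows "blk p q (four_block_mat X11 X12 X21 X22) i j =
    (if i < m then if j < n then blk p q X11 i j else blk p q X12 i (j - n)
     else if j < n then blk p q X21 (i - m) j else blk p q X22 (i - m) (j - n))"
proof -
  \<comment> \<open>An index lies before a cut exactly if its block does; with \<open>diff\<close>,
    comparisons and subtractions of entry indices become those of block numbers.\<close>
  have less_iff: "k * r + a < r * l \<longleftrightarrow> k < l" if "a < r" for k r a l :: nat
  proof
    assume *: "k * r + a < r * l"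
    show "k < l"
    proof (rule ccontr)
      assume "\<not> k < l"
      then have "r * l \<le> r * k" by (intro mult_le_mono2) simp
      moreover have "r * k \<le> k * r + a" by simp
      ultimately show False using * by linarith
    qed
  qed (rule block_index_less[OF _ that])
  have diff: "k * r + a - r * l = (k - l) * r + a" if "\<not> k < l" for k r a l :: nat
    using mult_le_mono1[of l k r] that by (simp add: diff_mult_distrib mult.commute[of r] not_less)
  show ?thesis
  proof (intro eq_matI, goal_cases)
    case (1 a b)
    then have ab: "a < p" "b < q" by (auto split: if_splits)
    have "i * p + a < p * m + p * m'" "j * q + b < q * n + q * n'"
      using block_index_less[OF assms(5) ab(1)] block_index_less[OF assms(6) ab(2)]
      by (simp_all add: distrib_left)
    moreover have "dim_row X11 = p * m" "dim_col X11 = q * n" "dim_row X22 = p * m'" "dim_col X22 = q * n'"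
      using assms by auto
    ultimately show ?case
      using ab by (cases "i < m"; cases "j < n") (simp_all add: less_iff diff)
  qed auto
qed

lemma blockwise_four_block_mat:
  assumes "s \<ge> 1" "mat_linear s s p q F"
    and X: "X11 \<in> carrier_mat (s * m) (s * n)" "X12 \<in> carrier_mat (s * m) (s * n')"
    "X21 \<in> carrier_mat (s * m') (s * n)" "X22 \<in> carrier_mat (s * m') (s * n')"
  shows "blockwise s p q F (four_block_mat X11 X12 X21 X22) =
    four_block_mat (blockwise s p q F X11) (blockwise s p q F X12)
      (blockwise s p q F X21) (blockwise s p q F X22)"
proof (rule eq_blkI[of _ p "m + m'" q "n + n'"])
  have X': "four_block_mat X11 X12 X21 X22 \<in> carrier_mat (s * (m + m')) (s * (n + n'))"
    using four_block_carrier_mat[OF X(1) X(4)] by (simp add: distrib_left)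
  show "blockwise s p q F (four_block_mat X11 X12 X21 X22) \<in> carrier_mat (p * (m + m')) (q * (n + n'))"
    using assms(1) X' by (rule blockwise_carrier)
  note bc = blockwise_carrier[OF assms(1)]
  show "four_block_mat (blockwise s p q F X11) (blockwise s p q F X12)
      (blockwise s p q F X21) (blockwise s p q F X22) \<in> carrier_mat (p * (m + m')) (q * (n + n'))"
    using four_block_carrier_mat[OF bc[OF X(1)] bc[OF X(4)]] by (simp add: distrib_left)
  fix i j assume ij: "i < m + m'" "j < n + n'"
  show "blk p q (blockwise s p q F (four_block_mat X11 X12 X21 X22)) i j =
    blk p q (four_block_mat (blockwise s p q F X11) (blockwise s p q F X12)
      (blockwise s p q F X21) (blockwise s p q F X22)) i j"
    unfolding blk_blockwise[OF assms(1) X' assms(2) ij] blk_four_block_mat[OF X ij]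
      blk_four_block_mat[OF bc[OF X(1)] bc[OF X(2)] bc[OF X(3)] bc[OF X(4)] ij]
    using ij by (simp add: blk_blockwise[OF assms(1) X(1) assms(2)] blk_blockwise[OF assms(1) X(2) assms(2)]
        blk_blockwise[OF assms(1) X(3) assms(2)] blk_blockwise[OF assms(1) X(4) assms(2)])
qed

section \<open>Algebra of rectangular matrices\<close>

text \<open>In this group of laws the premises compare \<open>dim_row\<close> and
  \<open>dim_col\<close> of the matrices themselves and contain no further dimension variables. The
  laws can thus serve as conditional rewrite rules that bring sums of products of rectangular
  matrices to a normal form.\<close>

lemma mult_assoc_dim:
  "dim_col A = dim_row B \<Longrightarrow> dim_col B = dim_row C \<Longrightarrow> A * B * C = A * (B * C :: 'a::semiring_0 mat)"
  by (rule assoc_mult_mat[of _ "dim_row A" "dim_col A" _ "dim_col B" _ "dim_col C"]) auto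

lemma mult_add_distrib_dim:
  "dim_col A = dim_row B \<Longrightarrow> dim_row B = dim_row C \<Longrightarrow> dim_col B = dim_col C \<Longrightarrow>
    A * (B + C) = A * B + A * (C :: 'a::semiring_0 mat)"
  by (rule mult_add_distrib_mat[of _ "dim_row A" "dim_col A" _ "dim_col C"]) auto

lemma add_mult_distrib_dim:
  "dim_col A = dim_row C \<Longrightarrow> dim_row A = dim_row B \<Longrightarrow> dim_col A = dim_col B \<Longrightarrow>
    (A + B) * C = A * C + B * (C :: 'a::semiring_0 mat)"
  by (rule add_mult_distrib_mat[of _ "dim_row A" "dim_col A" _ _ "dim_col C"]) auto

lemma add_assoc_dim:
  "dim_row A = dim_row B \<Longrightarrow> dim_row B = dim_row C \<Longrightarrow> dim_col A = dim_col B \<Longrightarrow> dim_col B = dim_col C \<Longrightarrow>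
    A + B + C = A + (B + C :: 'a::semiring_0 mat)"
  by (intro eq_matI) (auto simp: add.assoc)

lemma add_commute_dim:
  "dim_row A = dim_row B \<Longrightarrow> dim_col A = dim_col B \<Longrightarrow> A + B = B + (A :: 'a::semiring_0 mat)"
  by (intro eq_matI) (auto simp: add.commute)

lemma add_left_commute_dim:
  "dim_row A = dim_row B \<Longrightarrow> dim_row B = dim_row C \<Longrightarrow> dim_col A = dim_col B \<Longrightarrow> dim_col B = dim_col C \<Longrightarrow>
    A + (B + C) = B + (A + C :: 'a::semiring_0 mat)"
  by (intro eq_matI) (auto simp: add.left_commute)

lemmas mat_algebra_dim = mult_assoc_dim mult_add_distrib_dim add_mult_distrib_dim
  add_assoc_dim add_commute_dim add_left_commute_dim

lemma mat_eq_add_if_minus_eq: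
  fixes X :: "'a::ab_group_add mat"
  assumes "X - X' = Z" "X \<in> carrier_mat p q" "X' \<in> carrier_mat p q"
  shows "X = X' + Z"
  unfolding assms(1)[symmetric] using assms(2,3) by (intro eq_matI) auto

text \<open>A nonzero determinant makes M a unit of the matrix ring, which rules out the value
  \<open>None\<close> behind \<open>mat_inv\<close>.\<close>

lemma mat_inv:
  assumes "M \<in> carrier_mat n n" "det M \<noteq> 0"
  shows "mat_inv M \<in> carrier_mat n n" "M * mat_inv M = 1\<^sub>m n" "mat_inv M * M = 1\<^sub>m n"
proof -
  obtain M' where "mat_inverse M = Some M'"
    using mat_inverse(1)[OF assms(1), where b = "()"] det_non_zero_imp_unit[OF assms, where b = "()"]
    by (cases "mat_inverse M") auto
  then show "mat_inv M \<in> carrier_mat n n" "M * mat_inv M = 1\<^sub>m n" "mat_inv M * M = 1\<^sub>m n"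
    using mat_inverse(2)[OF assms(1)] by (auto simp: mat_inv_def)
qed

text \<open>From det M * det N = 1 the determinant of M is nonzero, so \<open>mat_inv M\<close> is a
  two-sided inverse and can be compared with N by associativity.\<close>

lemma mat_inv_unique:
  assumes M: "M \<in> carrier_mat n n" and N: "N \<in> carrier_mat n n" and MN: "M * N = 1\<^sub>m n"
  shows "mat_inv M = N"
proof -
  have "det M * det N = 1" using det_mult[OF M N] MN by simp
  then have "det M \<noteq> 0" by auto
  note inv = mat_inv[OF M this]
  have "mat_inv M = mat_inv M * (M * N)" using inv(1) MN by simp
  also have "\<dots> = mat_inv M * M * N" using assoc_mult_mat[OF inv(1) M N] by simp
  also have "\<dots> = N" using inv(3) N by simp
  finally show ?thesis .
qed

lemma det_nonzero_if_invertible_mat: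
  assumes "invertible_mat (M :: 'a::field mat)" "M \<in> carrier_mat n n"
  shows "det M \<noteq> 0"
proof -
  obtain N where MN: "M * N = 1\<^sub>m (dim_row M)" and NM: "N * M = 1\<^sub>m (dim_row N)"
    using assms(1) unfolding invertible_mat_def inverts_mat_def by auto
  \<comment> \<open>\<open>invertible_mat\<close> does not state the shape of N; it is read off the
    column numbers of the two identity matrices.\<close>
  have "dim_col (M * N) = n" "dim_col (N * M) = dim_row N"
    unfolding MN NM using assms(2) by auto
  then have N: "N \<in> carrier_mat n n" using assms(2) by auto
  have "det M * det N = 1" using det_mult[OF assms(2) N] MN assms(2) by simp
  then show ?thesis by auto
qed

text \<open>\<open>R = F + (E + P) * G\<close> with \<open>G = (1 - a)\<^sup>-\<^sup>1 b\<close> satisfies \<open>R = F + a' * R\<close>, that is,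
  \<open>R = (1 - a')\<^sup>-\<^sup>1 F\<close>, and \<open>T * C * G = C * R\<close>.\<close>
lemma resolvent_intertwining:
  fixes a :: "'a::field mat"
  assumes carrier: "a \<in> carrier_mat N N" "a' \<in> carrier_mat N N" "E \<in> carrier_mat N N"
      "P \<in> carrier_mat N N" "b \<in> carrier_mat N n" "b' \<in> carrier_mat N n" "F \<in> carrier_mat N n"
      "Q \<in> carrier_mat N n" "C \<in> carrier_mat n N" "D \<in> carrier_mat n n" "T \<in> carrier_mat n n"
      "U \<in> carrier_mat N N" "U' \<in> carrier_mat N N"
    and U: "(1\<^sub>m N - a) * U = 1\<^sub>m N" and U': "U' * (1\<^sub>m N - a') = 1\<^sub>m N"
    and D: "T * D = D * T + C * Q"
    and Cb: "T * C * b = C * (F + P * b)" and Ca: "T * C * a = C * (E + P * a)"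
    and B: "F + Q = b' * T + a' * Q"
    and Ab: "(E + P) * b = a' * (F + P * b)" and Aa: "(E + P) * a = a' * (E + P * a)"
  shows "T * (D + C * U * b) = (D + C * U' * b') * T"
proof -
  define G where "G = U * b"
  define R where "R = F + (E + P) * G"
  note dims = carrier[THEN carrier_matD(1)] carrier[THEN carrier_matD(2)]
  have cG: "G \<in> carrier_mat N n" and cR: "R \<in> carrier_mat N n"
    using carrier by (auto simp: G_def R_def)
  note dims = dims cG[THEN carrier_matD(1)] cG[THEN carrier_matD(2)]
    cR[THEN carrier_matD(1)] cR[THEN carrier_matD(2)]
  \<comment> \<open>Additive substitute for (1 - M) X = X - M X: the computation stays within sums,
    and \<open>cancel\<close> later removes the common summand.\<close>
  have split: "1\<^sub>m N * X = (1\<^sub>m N - M) * X + M * X"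
    if "M \<in> carrier_mat N N" "X \<in> carrier_mat N n" for M X :: "'a mat"
  proof -
    have "1\<^sub>m N - M + M = 1\<^sub>m N" using that by (intro eq_matI) auto
    then show ?thesis
      using add_mult_distrib_mat[of "1\<^sub>m N - M" N N M X n] that by (simp add: minus_carrier_mat)
  qed
  have "(1\<^sub>m N - a) * G = b"
    using carrier unfolding G_def by (subst assoc_mult_mat[symmetric, of _ N N _ N _ n]) (auto simp: U)
  then have G: "G = b + a * G" using split[OF carrier(1) cG] cG by simp
  \<comment> \<open>G is expanded as b + a G behind P only. This produces the combinations F + P b
    and E + P a, the ones in which the premises \<open>Cb\<close>, \<open>Ca\<close>,
    \<open>Ab\<close> and \<open>Aa\<close> know P.\<close>
  have R: "R = F + P * b + (E + P * a) * G"
  proof -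
    have "R = F + (E * G + P * (b + a * G))"
      unfolding R_def using G by (simp add: mat_algebra_dim dims)
    then show ?thesis by (simp add: mat_algebra_dim dims)
  qed
  have CR: "T * C * G = C * R"
  proof -
    have "T * C * G = T * C * (b + a * G)" using G by simp
    also have "\<dots> = T * C * b + T * C * a * G" by (simp add: mat_algebra_dim dims)
    also have "\<dots> = C * R" unfolding Cb Ca R by (simp add: mat_algebra_dim dims)
    finally show ?thesis .
  qed
  \<comment> \<open>By \<open>Ab\<close> and \<open>Aa\<close>, a' R becomes (E + P) b + (E + P) a G
    = (E + P) G, which is R without its summand F.\<close>
  have "a' * R = a' * (F + P * b) + a' * (E + P * a) * G"
    unfolding R by (simp add: mat_algebra_dim dims)
  also have "\<dots> = (E + P) * (b + a * G)"
    unfolding Ab[symmetric] Aa[symmetric] by (simp add: mat_algebra_dim dims)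
  finally have "R = F + a' * R" unfolding R_def using G by simp
  then have aR: "(1\<^sub>m N - a') * R + a' * R = F + a' * R" using split[OF carrier(2) cR] cR by simp
  have aQ: "(1\<^sub>m N - a') * Q + a' * Q = Q" using split[OF carrier(2,8)] carrier by simp
  have cancel: "X = X'" if "X + Z = X' + Z" "X \<in> carrier_mat N n" "X' \<in> carrier_mat N n" "Z \<in> carrier_mat N n"
    for X X' Z :: "'a mat"
  proof (intro eq_matI)
    fix i j assume ij: "i < dim_row X'" "j < dim_col X'"
    from that(1) have "(X + Z) $$ (i, j) = (X' + Z) $$ (i, j)" by simp
    then show "X $$ (i, j) = X' $$ (i, j)" using that(2-) ij by simp
  qed (use that in auto)
  have R_eq: "(1\<^sub>m N - a') * R = F"
    using carrier cR by (intro cancel[OF aR]) auto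
  \<comment> \<open>Premise \<open>B\<close> with F replaced by (1 - a') R and Q by (1 - a') Q + a'
    Q: everything except a' Q acquires the left factor 1 - a', which U' then removes.\<close>
  have "b' * T + a' * Q = (1\<^sub>m N - a') * (R + Q) + a' * Q"
  proof -
    have "b' * T + a' * Q = F + ((1\<^sub>m N - a') * Q + a' * Q)" unfolding aQ B ..
    also have "\<dots> = (1\<^sub>m N - a') * R + (1\<^sub>m N - a') * Q + a' * Q"
      unfolding R_eq by (rule add_assoc_dim[symmetric]) (simp_all add: dims)
    also have "(1\<^sub>m N - a') * R + (1\<^sub>m N - a') * Q = (1\<^sub>m N - a') * (R + Q)"
      by (rule mult_add_distrib_dim[symmetric]) (simp_all add: dims)
    finally show ?thesis .
  qed
  then have "b' * T = (1\<^sub>m N - a') * (R + Q)"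
    by (rule cancel) (use carrier cR in auto)
  then have "U' * (b' * T) = U' * (1\<^sub>m N - a') * (R + Q)"
    by (simp add: mult_assoc_dim dims)
  then have b'T: "U' * (b' * T) = R + Q"
    using U' cR carrier(8) by simp
  \<comment> \<open>The defect C Q of T and D is exactly what R lacks compared with U' b' T = R +
    Q.\<close>
  have "T * (D + C * U * b) = T * D + T * C * G"
    by (simp add: G_def mat_algebra_dim dims)
  also have "\<dots> = D * T + C * (R + Q)"
    unfolding D CR by (simp add: mat_algebra_dim dims)
  also have "\<dots> = (D + C * U' * b') * T"
    unfolding b'T[symmetric] by (simp add: mat_algebra_dim dims)
  finally show ?thesis .
qed

section \<open>Block extension of product identities\<close>

text \<open>Block (i, j) of Z S is the sum over k of products of blocks, and each term of
  \<open>eq\<close> is additive in Z and in S, so the identity for blocks sums up to the identity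
  for matrices. It serves the condition for B and, with G and H as right multiplication by D and C,
  the condition for D.\<close>

lemma blockwise_mult_right:
  assumes s: "s \<ge> 1" and Z: "Z \<in> carrier_mat (s * m) (s * n)" and S: "S \<in> carrier_mat (s * n) (s * l)"
    and G: "mat_linear s s p s G" and H: "mat_linear s s p q H" and Q: "mat_linear s s q s Q"
    and eq: "\<And>Z S. Z \<in> carrier_mat s s \<Longrightarrow> S \<in> carrier_mat s s \<Longrightarrow> G (Z * S) = G Z * S + H Z * Q S"
  shows "blockwise s p s G (Z * S) = blockwise s p s G Z * S + blockwise s p q H Z * blockwise s q s Q S"
proof (rule eq_blkI[of _ p m s l])
  note bc = blockwise_carrier[OF s]
  have ZS: "Z * S \<in> carrier_mat (s * m) (s * l)" using Z S by simp
  have c1: "blockwise s p s G Z * S \<in> carrier_mat (p * m) (s * l)"    by (rule mult_carrier_mat[OF bc[OF Z] S])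
  have c2: "blockwise s p q H Z * blockwise s q s Q S \<in> carrier_mat (p * m) (s * l)"
       by (rule mult_carrier_mat[OF bc[OF Z] bc[OF S]])
  show "blockwise s p s G (Z * S) \<in> carrier_mat (p * m) (s * l)" by (rule bc[OF ZS])
  show "blockwise s p s G Z * S + blockwise s p q H Z * blockwise s q s Q S \<in> carrier_mat (p * m) (s * l)"
    using c2 by (rule add_carrier_mat)
  fix i j assume ij: "i < m" "j < l"
  let ?Z = "blk s s Z i" and ?S = "\<lambda>k. blk s s S k j"
  have lin: "G X \<in> carrier_mat p s" "H X \<in> carrier_mat p q" "Q X \<in> carrier_mat q s"
    if "X \<in> carrier_mat s s" for X
    using G H Q that by (auto intro: mat_linear_carrier)
  have "blk p s (blockwise s p s G (Z * S)) i j = G (mat_sum s s n (\<lambda>k. ?Z k * ?S k))"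
    by (simp add: blk_blockwise[OF s ZS G ij] blk_mult[OF Z S ij])
  also have "\<dots> = mat_sum p s n (\<lambda>k. G (?Z k * ?S k))"
    by (intro mat_linear_mat_sum[OF G] mult_carrier_mat[OF blk_carrier blk_carrier])
  also have "\<dots> = mat_sum p s n (\<lambda>k. G (?Z k) * ?S k + H (?Z k) * Q (?S k))"
    by (simp add: eq)
  also have "\<dots> = mat_sum p s n (\<lambda>k. G (?Z k) * ?S k) + mat_sum p s n (\<lambda>k. H (?Z k) * Q (?S k))"
    by (intro mat_sum_add mult_carrier_mat[OF lin(1)] mult_carrier_mat[OF lin(2) lin(3)]) simp_all
  also have "mat_sum p s n (\<lambda>k. G (?Z k) * ?S k) = blk p s (blockwise s p s G Z * S) i j"
    unfolding blk_mult[OF bc[OF Z] S ij]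
    by (intro mat_sum_cong) (simp add: blk_blockwise[OF s Z G ij(1)])
  also have "mat_sum p s n (\<lambda>k. H (?Z k) * Q (?S k))
      = blk p s (blockwise s p q H Z * blockwise s q s Q S) i j"
    unfolding blk_mult[OF bc[OF Z] bc[OF S] ij]
    by (intro mat_sum_cong) (simp add: blk_blockwise[OF s Z H ij(1)] blk_blockwise[OF s S Q _ ij(2)])
  finally show "blk p s (blockwise s p s G (Z * S)) i j
      = blk p s (blockwise s p s G Z * S + blockwise s p q H Z * blockwise s q s Q S) i j"
    unfolding blk_add[OF c1 c2 ij] .
qed

text \<open>Block (i, j) of either side is a double sum, over the column index k of Z and the row
  index t of Z'; linearity of H and G reduces it to \<open>eq\<close> for triples of blocks. This
  serves the four conditions that involve P.\<close>

lemma blockwise_mult_middle: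
  assumes s: "s \<ge> 1" and Z: "Z \<in> carrier_mat (s * m) (s * n)" and S: "S \<in> carrier_mat (s * n) (s * n')"
    and Z': "Z' \<in> carrier_mat (s * n') (s * l)"
    and H: "mat_linear s s p q H" and G: "mat_linear s s q r G" and P: "mat_linear s s q q P"
    and eq: "\<And>Z S Z'. Z \<in> carrier_mat s s \<Longrightarrow> S \<in> carrier_mat s s \<Longrightarrow> Z' \<in> carrier_mat s s \<Longrightarrow>
      H (Z * S) * G Z' = H Z * (G (S * Z') + P S * G Z')"
  shows "blockwise s p q H (Z * S) * blockwise s q r G Z' =
    blockwise s p q H Z * (blockwise s q r G (S * Z') + blockwise s q q P S * blockwise s q r G Z')"
proof (rule eq_blkI[of _ p m r l])
  note bc = blockwise_carrier[OF s]
  have ZS: "Z * S \<in> carrier_mat (s * m) (s * n')" and SZ: "S * Z' \<in> carrier_mat (s * n) (s * l)"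
    using Z S Z' by auto
  have c1: "blockwise s q q P S * blockwise s q r G Z' \<in> carrier_mat (q * n) (r * l)"
       by (rule mult_carrier_mat[OF bc[OF S] bc[OF Z']])
  have c2: "blockwise s q r G (S * Z') + blockwise s q q P S * blockwise s q r G Z' \<in> carrier_mat (q * n) (r * l)"
    using c1 by (rule add_carrier_mat)
  show "blockwise s p q H (Z * S) * blockwise s q r G Z' \<in> carrier_mat (p * m) (r * l)"
    by (rule mult_carrier_mat[OF bc[OF ZS] bc[OF Z']])
  show "blockwise s p q H Z * (blockwise s q r G (S * Z') + blockwise s q q P S * blockwise s q r G Z')
      \<in> carrier_mat (p * m) (r * l)"
    by (rule mult_carrier_mat[OF bc[OF Z] c2])
  fix i j assume ij: "i < m" "j < l"
  let ?Z = "blk s s Z i" and ?S = "blk s s S" and ?Z' = "\<lambda>k. blk s s Z' k j"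
  have cH: "H X \<in> carrier_mat p q" and cG: "G X \<in> carrier_mat q r" and cP: "P X \<in> carrier_mat q q"
    if "X \<in> carrier_mat s s" for X
    using G H P that by (auto intro: mat_linear_carrier)
  have sq: "blk s s X k k' * blk s s X' l l' \<in> carrier_mat s s" for X X' :: "'a mat" and k k' l l'
    by (rule mult_carrier_mat[OF blk_carrier blk_carrier])
  have PG: "P (?S k t) * G (?Z' t) \<in> carrier_mat q r" for k t
    by (rule mult_carrier_mat[OF cP cG]) simp_all
  have "blk p r (blockwise s p q H (Z * S) * blockwise s q r G Z') i j
      = mat_sum p r n' (\<lambda>t. H (mat_sum s s n (\<lambda>k. ?Z k * ?S k t)) * G (?Z' t))"
    unfolding blk_mult[OF bc[OF ZS] bc[OF Z'] ij]
    by (intro mat_sum_cong)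
      (simp add: blk_blockwise[OF s ZS H ij(1)] blk_blockwise[OF s Z' G _ ij(2)] blk_mult[OF Z S ij(1)])
  also have "\<dots> = mat_sum p r n' (\<lambda>t. mat_sum p r n (\<lambda>k. H (?Z k * ?S k t) * G (?Z' t)))"
  proof (intro mat_sum_cong)
    fix t
    show "H (mat_sum s s n (\<lambda>k. ?Z k * ?S k t)) * G (?Z' t)
        = mat_sum p r n (\<lambda>k. H (?Z k * ?S k t) * G (?Z' t))"
      unfolding mat_linear_mat_sum[OF H sq] by (rule mat_sum_mult_right[OF cH[OF sq] cG[OF blk_carrier]])
  qed
  \<comment> \<open>The block of Z depends on k alone, so k becomes the outer index and H of that
    block can leave the sum over t.\<close>
  also have "\<dots> = mat_sum p r n (\<lambda>k. mat_sum p r n' (\<lambda>t. H (?Z k) * (G (?S k t * ?Z' t) + P (?S k t) * G (?Z' t))))"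
    by (subst mat_sum_swap) (simp add: eq)
  also have "\<dots> = mat_sum p r n (\<lambda>k. H (?Z k) *
      (mat_sum q r n' (\<lambda>t. G (?S k t * ?Z' t)) + mat_sum q r n' (\<lambda>t. P (?S k t) * G (?Z' t))))"
  proof (intro mat_sum_cong)
    fix k
    show "mat_sum p r n' (\<lambda>t. H (?Z k) * (G (?S k t * ?Z' t) + P (?S k t) * G (?Z' t)))
        = H (?Z k) * (mat_sum q r n' (\<lambda>t. G (?S k t * ?Z' t)) + mat_sum q r n' (\<lambda>t. P (?S k t) * G (?Z' t)))"
      unfolding mat_sum_add[OF cG[OF sq] PG, symmetric]
      by (rule mat_sum_mult_left[OF cH[OF blk_carrier] add_carrier_mat[OF PG], symmetric])
  qed
  also have "\<dots> = mat_sum p r n (\<lambda>k. blk p q (blockwise s p q H Z) i k *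
      blk q r (blockwise s q r G (S * Z') + blockwise s q q P S * blockwise s q r G Z') k j)"
  proof (intro mat_sum_cong)
    fix k assume k: "k < n"
    have "mat_sum q r n' (\<lambda>t. G (?S k t * ?Z' t)) = blk q r (blockwise s q r G (S * Z')) k j"
      unfolding blk_blockwise[OF s SZ G k ij(2)] blk_mult[OF S Z' k ij(2)]
      by (rule mat_linear_mat_sum[OF G sq, symmetric])
    moreover have "mat_sum q r n' (\<lambda>t. P (?S k t) * G (?Z' t))
        = blk q r (blockwise s q q P S * blockwise s q r G Z') k j"
      unfolding blk_mult[OF bc[OF S] bc[OF Z'] k ij(2)]
      by (intro mat_sum_cong) (simp add: blk_blockwise[OF s S P k] blk_blockwise[OF s Z' G _ ij(2)])
    ultimately show "H (?Z k) * (mat_sum q r n' (\<lambda>t. G (?S k t * ?Z' t)) + mat_sum q r n' (\<lambda>t. P (?S k t) * G (?Z' t)))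
        = blk p q (blockwise s p q H Z) i k *
          blk q r (blockwise s q r G (S * Z') + blockwise s q q P S * blockwise s q r G Z') k j"
      by (simp add: blk_blockwise[OF s Z H ij(1) k] blk_add[OF bc[OF SZ] c1 k ij(2)])
  qed
  also have "\<dots> = blk p r (blockwise s p q H Z *
      (blockwise s q r G (S * Z') + blockwise s q q P S * blockwise s q r G Z')) i j"
    by (rule blk_mult[OF bc[OF Z] c2 ij, symmetric])
  finally show "blk p r (blockwise s p q H (Z * S) * blockwise s q r G Z') i j = \<dots>" .
qed

text \<open>At W_k = X_k - I \<otimes> Y_k this is the sum inside \<Lambda> (for F = A) or the last
  factor of the transfer function (for F = B). Arbitrary W are allowed because the proof also needs
  the values at T W_k and at commutators with T.\<close>

definition blockwise_sum ::
    "nat \<Rightarrow> nat \<Rightarrow> nat \<Rightarrow> nat \<Rightarrow> (nat \<Rightarrow> 'a::field mat \<Rightarrow> 'a mat) \<Rightarrow> nat \<Rightarrow> nat \<Rightarrow> (nat \<Rightarrow> 'a mat) \<Rightarrow> 'a mat"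
  where "blockwise_sum s p q d F m n W = mat_sum (p * m) (q * n) d (\<lambda>k. blockwise s p q (F k) (W k))"

lemma blockwise_sum_carrier [simp]: "blockwise_sum s p q d F m n W \<in> carrier_mat (p * m) (q * n)"
  by (simp add: blockwise_sum_def)

lemma blockwise_sum_cong:
  "(\<And>k. k < d \<Longrightarrow> W k = W' k) \<Longrightarrow> blockwise_sum s p q d F m n W = blockwise_sum s p q d F m n W'"
  unfolding blockwise_sum_def by (intro mat_sum_cong) simp

lemma blockwise_sum_add:
  assumes s: "s \<ge> 1" and F: "\<And>k. k < d \<Longrightarrow> mat_linear s s p q (F k)"
    and W: "\<And>k. k < d \<Longrightarrow> W k \<in> carrier_mat (s * m) (s * n)"
    and W': "\<And>k. k < d \<Longrightarrow> W' k \<in> carrier_mat (s * m) (s * n)"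
  shows "blockwise_sum s p q d F m n (\<lambda>k. W k + W' k) =
    blockwise_sum s p q d F m n W + blockwise_sum s p q d F m n W'"
proof -
  have "blockwise_sum s p q d F m n (\<lambda>k. W k + W' k)
      = mat_sum (p * m) (q * n) d (\<lambda>k. blockwise s p q (F k) (W k) + blockwise s p q (F k) (W' k))"
    unfolding blockwise_sum_def by (intro mat_sum_cong blockwise_add[OF s W W' F])
  also have "\<dots> = blockwise_sum s p q d F m n W + blockwise_sum s p q d F m n W'"
    unfolding blockwise_sum_def by (intro mat_sum_add blockwise_carrier[OF s W] blockwise_carrier[OF s W'])
  finally show ?thesis .
qed

lemma blockwise_sum_mult_right:
  assumes s: "s \<ge> 1" and Z: "\<And>i. i < d \<Longrightarrow> Z i \<in> carrier_mat (s * m) (s * n)"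
    and S: "S \<in> carrier_mat (s * n) (s * l)"
    and G: "\<And>i. i < d \<Longrightarrow> mat_linear s s p s (G i)" and H: "\<And>i. i < d \<Longrightarrow> mat_linear s s p q (H i)"
    and Q: "mat_linear s s q s Q"
    and eq: "\<And>i Z S. i < d \<Longrightarrow> Z \<in> carrier_mat s s \<Longrightarrow> S \<in> carrier_mat s s \<Longrightarrow>
      G i (Z * S) = G i Z * S + H i Z * Q S"
  shows "blockwise_sum s p s d G m l (\<lambda>i. Z i * S) =
    blockwise_sum s p s d G m n Z * S + blockwise_sum s p q d H m n Z * blockwise s q s Q S"
proof -
  note bc = blockwise_carrier[OF s]
  have "blockwise_sum s p s d G m l (\<lambda>i. Z i * S) = mat_sum (p * m) (s * l) d
      (\<lambda>i. blockwise s p s (G i) (Z i) * S + blockwise s p q (H i) (Z i) * blockwise s q s Q S)"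
    unfolding blockwise_sum_def by (intro mat_sum_cong blockwise_mult_right[OF s Z S G H Q eq])
  also have "\<dots> = mat_sum (p * m) (s * l) d (\<lambda>i. blockwise s p s (G i) (Z i) * S)
      + mat_sum (p * m) (s * l) d (\<lambda>i. blockwise s p q (H i) (Z i) * blockwise s q s Q S)"
    by (rule mat_sum_add[OF mult_carrier_mat[OF bc[OF Z] S] mult_carrier_mat[OF bc[OF Z] bc[OF S]]])
  also have "\<dots> = blockwise_sum s p s d G m n Z * S + blockwise_sum s p q d H m n Z * blockwise s q s Q S"
    by (simp only: blockwise_sum_def mat_sum_mult_right[OF bc[OF Z] S] mat_sum_mult_right[OF bc[OF Z] bc[OF S]])
  finally show ?thesis .
qed

text \<open>Only the right factor is summed over coordinates. With H as right multiplication by C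
  this already is the form needed for the two C-conditions involving P, which carry no index on the
  left; the A-conditions need a further sum over i.\<close>

lemma blockwise_mult_sum_middle:
  assumes s: "s \<ge> 1" and Z: "Z \<in> carrier_mat (s * m) (s * n)" and S: "S \<in> carrier_mat (s * n) (s * n')"
    and Z': "\<And>j. j < d \<Longrightarrow> Z' j \<in> carrier_mat (s * n') (s * l)"
    and H: "mat_linear s s p q H" and G: "\<And>j. j < d \<Longrightarrow> mat_linear s s q r (G j)"
    and P: "mat_linear s s q q P"
    and eq: "\<And>j Z S Z'. j < d \<Longrightarrow> Z \<in> carrier_mat s s \<Longrightarrow> S \<in> carrier_mat s s \<Longrightarrow> Z' \<in> carrier_mat s s \<Longrightarrow>
      H (Z * S) * G j Z' = H Z * (G j (S * Z') + P S * G j Z')"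
  shows "blockwise s p q H (Z * S) * blockwise_sum s q r d G n' l Z' = blockwise s p q H Z *
    (blockwise_sum s q r d G n l (\<lambda>j. S * Z' j) + blockwise s q q P S * blockwise_sum s q r d G n' l Z')"
proof -
  note bc = blockwise_carrier[OF s]
  have ZS: "Z * S \<in> carrier_mat (s * m) (s * n')" using Z S by simp
  have SZ': "S * Z' j \<in> carrier_mat (s * n) (s * l)" if "j < d" for j using S Z'[OF that] by simp
  have c1: "blockwise s q q P S * blockwise s q r (G j) (Z' j) \<in> carrier_mat (q * n) (r * l)" if "j < d" for j
    by (rule mult_carrier_mat[OF bc[OF S] bc[OF Z'[OF that]]])
  let ?T = "\<lambda>j. blockwise s q r (G j) (S * Z' j) + blockwise s q q P S * blockwise s q r (G j) (Z' j)"
  have "blockwise s p q H (Z * S) * blockwise_sum s q r d G n' l Z'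
      = mat_sum (p * m) (r * l) d (\<lambda>j. blockwise s p q H (Z * S) * blockwise s q r (G j) (Z' j))"
    unfolding blockwise_sum_def by (rule mat_sum_mult_left[OF bc[OF ZS] bc[OF Z']])
  also have "\<dots> = mat_sum (p * m) (r * l) d (\<lambda>j. blockwise s p q H Z * ?T j)"
    by (intro mat_sum_cong blockwise_mult_middle[OF s Z S Z' H G P eq])
  also have "\<dots> = blockwise s p q H Z * mat_sum (q * n) (r * l) d ?T"
    by (rule mat_sum_mult_left[OF bc[OF Z] add_carrier_mat[OF c1], symmetric])
  also have "mat_sum (q * n) (r * l) d ?T
      = blockwise_sum s q r d G n l (\<lambda>j. S * Z' j) + blockwise s q q P S * blockwise_sum s q r d G n' l Z'"
    by (simp only: blockwise_sum_def mat_sum_mult_left[OF bc[OF S] bc[OF Z']] mat_sum_add[OF bc[OF SZ'] c1])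
  finally show ?thesis .
qed

lemma blockwise_sum_mult_middle:
  assumes s: "s \<ge> 1" and Z: "\<And>i. i < d \<Longrightarrow> Z i \<in> carrier_mat (s * m) (s * n)"
    and S: "S \<in> carrier_mat (s * n) (s * n')"
    and Z': "\<And>j. j < d \<Longrightarrow> Z' j \<in> carrier_mat (s * n') (s * l)"
    and H: "\<And>i. i < d \<Longrightarrow> mat_linear s s p q (H i)" and G: "\<And>j. j < d \<Longrightarrow> mat_linear s s q r (G j)"
    and P: "mat_linear s s q q P"
    and eq: "\<And>i j Z S Z'. i < d \<Longrightarrow> j < d \<Longrightarrow> Z \<in> carrier_mat s s \<Longrightarrow> S \<in> carrier_mat s s \<Longrightarrow>
      Z' \<in> carrier_mat s s \<Longrightarrow> H i (Z * S) * G j Z' = H i Z * (G j (S * Z') + P S * G j Z')"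
  shows "blockwise_sum s p q d H m n' (\<lambda>i. Z i * S) * blockwise_sum s q r d G n' l Z' =
    blockwise_sum s p q d H m n Z *
    (blockwise_sum s q r d G n l (\<lambda>j. S * Z' j) + blockwise s q q P S * blockwise_sum s q r d G n' l Z')"
    (is "_ * ?g = _ * ?T")
proof -
  note bc = blockwise_carrier[OF s]
  have ZS: "Z i * S \<in> carrier_mat (s * m) (s * n')" if "i < d" for i using Z[OF that] S by simp
  have T: "?T \<in> carrier_mat (q * n) (r * l)"
    by (rule add_carrier_mat[OF mult_carrier_mat[OF bc[OF S] blockwise_sum_carrier]])
  have "blockwise_sum s p q d H m n' (\<lambda>i. Z i * S) * ?g
      = mat_sum (p * m) (r * l) d (\<lambda>i. blockwise s p q (H i) (Z i * S) * ?g)"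
    unfolding blockwise_sum_def[of s p q] by (rule mat_sum_mult_right[OF bc[OF ZS] blockwise_sum_carrier])
  also have "\<dots> = mat_sum (p * m) (r * l) d (\<lambda>i. blockwise s p q (H i) (Z i) * ?T)"
    by (intro mat_sum_cong blockwise_mult_sum_middle[OF s Z S Z' H G P eq])
  also have "\<dots> = blockwise_sum s p q d H m n Z * ?T"
    unfolding blockwise_sum_def[of s p q] by (rule mat_sum_mult_right[OF bc[OF Z] T, symmetric])
  finally show ?thesis .
qed

section \<open>Constants and commutators as linear maps\<close>

lemma mat_linear_mult_right:
  assumes "M \<in> carrier_mat m q" shows "mat_linear n m n q (\<lambda>Z. Z * M)"
  using assms by (auto simp: mat_linear_def add_mult_distrib_mat mult_smult_assoc_mat)

text \<open>Makes I \<otimes> C the extension of Z -> Z C at the identity and T (I \<otimes> C) its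
  extension at T, so that C can take the place of a map A_i in the block extension lemmas; likewise
  D.\<close>

lemma blockwise_mult_const:
  assumes s: "s \<ge> 1" and X: "X \<in> carrier_mat (s * m) (s * n)" and M: "M \<in> carrier_mat s q"
  shows "blockwise s s q (\<lambda>Z. Z * M) X = X * kron (1\<^sub>m n) M"
proof (rule eq_blkI[of _ s m q n])
  show "blockwise s s q (\<lambda>Z. Z * M) X \<in> carrier_mat (s * m) (q * n)"
    by (rule blockwise_carrier[OF s X])
  show "X * kron (1\<^sub>m n) M \<in> carrier_mat (s * m) (q * n)"
    by (rule mult_carrier_mat[OF X kron_one_carrier[OF M]])
  fix i j assume ij: "i < m" "j < n"
  show "blk s q (blockwise s s q (\<lambda>Z. Z * M) X) i j = blk s q (X * kron (1\<^sub>m n) M) i j"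
    by (simp add: blk_blockwise[OF s X mat_linear_mult_right[OF M] ij] blk_mult_kron_one[OF X M ij])
qed

text \<open>The sums P and Q of the lost-abbey conditions as functions of S, since they must be
  extended blockwise in S.\<close>

definition commutator_sum ::
    "nat \<Rightarrow> nat \<Rightarrow> nat \<Rightarrow> (nat \<Rightarrow> 'a::field mat \<Rightarrow> 'a mat) \<Rightarrow> 'a mat list \<Rightarrow> 'a mat \<Rightarrow> 'a mat"
  where "commutator_sum p q d F Y S = mat_sum p q d (\<lambda>k. F k (commutator S (Y ! k)))"

lemma mat_linear_commutator:
  assumes "M \<in> carrier_mat s s" shows "mat_linear s s s s (\<lambda>S. commutator S M)"
  unfolding mat_linear_def
proof (intro conjI ballI allI)
  fix X X' :: "'a mat" and c assume X: "X \<in> carrier_mat s s" and X': "X' \<in> carrier_mat s s"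
  show "commutator (X + X') M = commutator X M + commutator X' M"
    unfolding commutator_def add_mult_distrib_mat[OF X X' assms] mult_add_distrib_mat[OF assms X X']
    using X X' assms by (intro eq_matI) auto
next
  fix X :: "'a mat" and c assume X: "X \<in> carrier_mat s s"
  show "commutator (c \<cdot>\<^sub>m X) M = c \<cdot>\<^sub>m commutator X M"
    unfolding commutator_def mult_smult_assoc_mat[OF X assms] mult_smult_distrib[OF assms X]
    using X assms by (intro eq_matI) (auto simp: right_diff_distrib)
qed (use assms in \<open>auto simp: commutator_def minus_carrier_mat\<close>)

lemma mat_linear_commutator_sum:
  assumes Y: "\<And>k. k < d \<Longrightarrow> Y ! k \<in> carrier_mat s s" and F: "\<And>k. k < d \<Longrightarrow> mat_linear s s p q (F k)"
  shows "mat_linear s s p q (commutator_sum p q d F Y)"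
  unfolding mat_linear_def
proof (intro conjI ballI allI)
  have comm: "commutator X (Y ! k) \<in> carrier_mat s s" if "k < d" "X \<in> carrier_mat s s" for k and X :: "'a mat"
    using mat_linear_carrier[OF mat_linear_commutator[OF Y[OF that(1)]] that(2)] .
  note F_carrier = mat_linear_carrier[OF F comm]
  show "commutator_sum p q d F Y X \<in> carrier_mat p q" for X :: "'a mat"
    by (simp add: commutator_sum_def)
  fix X :: "'a mat" assume X: "X \<in> carrier_mat s s"
  show "commutator_sum p q d F Y (X + X') = commutator_sum p q d F Y X + commutator_sum p q d F Y X'"
    if X': "X' \<in> carrier_mat s s" for X'
  proof -
    have "commutator_sum p q d F Y (X + X')
        = mat_sum p q d (\<lambda>k. F k (commutator X (Y ! k)) + F k (commutator X' (Y ! k)))"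
      unfolding commutator_sum_def
      by (intro mat_sum_cong)
        (simp add: mat_linear_add[OF mat_linear_commutator[OF Y] X X'] mat_linear_add[OF F comm[OF _ X] comm[OF _ X']])
    also have "\<dots> = commutator_sum p q d F Y X + commutator_sum p q d F Y X'"
      unfolding commutator_sum_def by (rule mat_sum_add[OF F_carrier[OF _ _ X] F_carrier[OF _ _ X']])
    finally show ?thesis .
  qed
  show "commutator_sum p q d F Y (c \<cdot>\<^sub>m X) = c \<cdot>\<^sub>m commutator_sum p q d F Y X" for c
  proof -
    have "F k (commutator (c \<cdot>\<^sub>m X) (Y ! k)) = c \<cdot>\<^sub>m F k (commutator X (Y ! k))" if "k < d" for k
      using mat_linear_commutator[OF Y[OF that]] F[OF that] X comm[OF that X] by (simp add: mat_linear_def)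
    then show ?thesis
      unfolding commutator_sum_def using carrier_matD[OF F_carrier[OF _ _ X]]
      by (intro eq_matI) (auto simp: sum_distrib_left intro!: sum.cong)
  qed
qed

text \<open>I \<otimes> Y_k is block diagonal with the same block Y_k throughout, so block (i, j) of
  its commutator with S is the commutator of the block S_ij with Y_k.\<close>

lemma blockwise_commutator_sum:
  assumes s: "s \<ge> 1" and Y: "\<And>k. k < d \<Longrightarrow> Y ! k \<in> carrier_mat s s"
    and F: "\<And>k. k < d \<Longrightarrow> mat_linear s s p q (F k)" and S: "S \<in> carrier_mat (s * m) (s * n)"
  shows "blockwise s p q (commutator_sum p q d F Y) S =
    blockwise_sum s p q d F m n (\<lambda>k. S * kron (1\<^sub>m n) (Y ! k) - kron (1\<^sub>m m) (Y ! k) * S)"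
proof (rule eq_blkI[of _ p m q n])
  show "blockwise s p q (commutator_sum p q d F Y) S \<in> carrier_mat (p * m) (q * n)"
    by (rule blockwise_carrier[OF s S])
  fix i j assume ij: "i < m" "j < n"
  have "F k (commutator (blk s s S i j) (Y ! k))
      = blk p q (blockwise s p q (F k) (S * kron (1\<^sub>m n) (Y ! k) - kron (1\<^sub>m m) (Y ! k) * S)) i j"
    if k: "k < d" for k
  proof -
    have c1: "S * kron (1\<^sub>m n) (Y ! k) \<in> carrier_mat (s * m) (s * n)"
      by (rule mult_carrier_mat[OF S kron_one_carrier[OF Y[OF k]]])
    have c2: "kron (1\<^sub>m m) (Y ! k) * S \<in> carrier_mat (s * m) (s * n)"
      by (rule mult_carrier_mat[OF kron_one_carrier[OF Y[OF k]] S])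
    show ?thesis
      by (simp add: blk_blockwise[OF s minus_carrier_mat[OF c2] F[OF k] ij] blk_minus[OF c1 c2 ij]
          blk_mult_kron_one[OF S Y[OF k] ij] blk_kron_one_mult[OF S Y[OF k] ij] commutator_def)
  qed
  then show "blk p q (blockwise s p q (commutator_sum p q d F Y) S) i j = blk p q (blockwise_sum s p q d F m n
      (\<lambda>k. S * kron (1\<^sub>m n) (Y ! k) - kron (1\<^sub>m m) (Y ! k) * S)) i j"
    by (simp add: blk_blockwise[OF s S mat_linear_commutator_sum[OF Y F] ij] blockwise_sum_def
        blk_mat_sum[OF ij] commutator_sum_def cong: mat_sum_cong)
qed simp

section \<open>Block triangular matrices and direct sums\<close>

lemma blk_zero:
  assumes "i < m" "j < n"
  shows "blk p q (0\<^sub>m (p * m) (q * n)) i j = 0\<^sub>m p q"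
  using assms by (intro eq_matI) (auto simp: block_index_less)

lemma blockwise_zero:
  assumes s: "s \<ge> 1" and F: "mat_linear s s p q F"
  shows "blockwise s p q F (0\<^sub>m (s * m) (s * n)) = 0\<^sub>m (p * m) (q * n)"
  by (rule eq_blkI[of _ p m q n])
    (simp_all add: blockwise_carrier[OF s] blk_zero mat_linear_zero[OF F]
      blk_blockwise[OF s zero_carrier_mat F])

lemma kron_one_four_block_mat:
  assumes M: "M \<in> carrier_mat p q"
  shows "kron (1\<^sub>m (m + m')) M = four_block_mat (kron (1\<^sub>m m) M) (0\<^sub>m (p * m) (q * m'))
    (0\<^sub>m (p * m') (q * m)) (kron (1\<^sub>m m') M)"
proof (rule eq_blkI[of _ p "m + m'" q "m + m'"])
  show "four_block_mat (kron (1\<^sub>m m) M) (0\<^sub>m (p * m) (q * m')) (0\<^sub>m (p * m') (q * m)) (kron (1\<^sub>m m') M)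
      \<in> carrier_mat (p * (m + m')) (q * (m + m'))"
    unfolding distrib_left
    by (rule four_block_carrier_mat[OF kron_one_carrier[OF M] kron_one_carrier[OF M]])
  fix i j assume ij: "i < m + m'" "j < m + m'"
  show "blk p q (kron (1\<^sub>m (m + m')) M) i j = blk p q (four_block_mat (kron (1\<^sub>m m) M)
      (0\<^sub>m (p * m) (q * m')) (0\<^sub>m (p * m') (q * m)) (kron (1\<^sub>m m') M)) i j"
    unfolding blk_kron_one[OF M ij] blk_four_block_mat[OF kron_one_carrier[OF M] zero_carrier_mat
      zero_carrier_mat kron_one_carrier[OF M] ij]
    using ij by (auto simp: blk_kron_one[OF M] blk_zero)
qed (rule kron_one_carrier[OF M])

lemma minus_four_block_mat:
  assumes "X11 \<in> carrier_mat m n" "X12 \<in> carrier_mat m n'" "X21 \<in> carrier_mat m' n" "X22 \<in> carrier_mat m' n'"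
    and "Y11 \<in> carrier_mat m n" "Y12 \<in> carrier_mat m n'" "Y21 \<in> carrier_mat m' n" "Y22 \<in> carrier_mat m' n'"
  shows "four_block_mat X11 X12 X21 X22 - four_block_mat Y11 Y12 Y21 Y22 =
    four_block_mat (X11 - Y11) (X12 - Y12) (X21 - Y21) (X22 - Y22)"
  using assms by (intro eq_matI) auto

lemma zero_minus_zero_mat [simp]: "0\<^sub>m m n - 0\<^sub>m m n = (0\<^sub>m m n :: 'a::ab_group_add mat)"
  by (intro eq_matI) auto

lemma mat_sum_four_block_mat:
  assumes "\<And>k. k < d \<Longrightarrow> X11 k \<in> carrier_mat m n" "\<And>k. k < d \<Longrightarrow> X22 k \<in> carrier_mat m' n'"
  shows "mat_sum (m + m') (n + n') d (\<lambda>k. four_block_mat (X11 k) (X12 k) (X21 k) (X22 k)) =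
    four_block_mat (mat_sum m n d X11) (mat_sum m n' d X12) (mat_sum m' n d X21) (mat_sum m' n' d X22)"
proof (rule eq_matI)
  fix i j assume "i < dim_row (four_block_mat (mat_sum m n d X11) (mat_sum m n' d X12) (mat_sum m' n d X21) (mat_sum m' n' d X22))"
    "j < dim_col (four_block_mat (mat_sum m n d X11) (mat_sum m n' d X12) (mat_sum m' n d X21) (mat_sum m' n' d X22))"
  then have ij: "i < m + m'" "j < n + n'" by auto
  have "four_block_mat (X11 k) (X12 k) (X21 k) (X22 k) $$ (i, j) =
      (if i < m then if j < n then X11 k $$ (i, j) else X12 k $$ (i, j - n)
       else if j < n then X21 k $$ (i - m, j) else X22 k $$ (i - m, j - n))" if "k < d" for k
    using assms(1)[OF that] assms(2)[OF that] ij by simp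
  then show "mat_sum (m + m') (n + n') d (\<lambda>k. four_block_mat (X11 k) (X12 k) (X21 k) (X22 k)) $$ (i, j) =
    four_block_mat (mat_sum m n d X11) (mat_sum m n' d X12) (mat_sum m' n d X21) (mat_sum m' n' d X22) $$ (i, j)"
    using ij by simp
qed auto

lemma blockwise_sum_zero:
  assumes s: "s \<ge> 1" and F: "\<And>k. k < d \<Longrightarrow> mat_linear s s p q (F k)"
  shows "blockwise_sum s p q d F m n (\<lambda>k. 0\<^sub>m (s * m) (s * n)) = 0\<^sub>m (p * m) (q * n)"
  unfolding blockwise_sum_def by (intro eq_matI) (auto simp: blockwise_zero[OF s F])

text \<open>Linear maps vanish at 0, so the zero corner stays zero and the triangular shape survives
  the extension.\<close>

lemma blockwise_sum_four_block_mat: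
  assumes s: "s \<ge> 1" and F: "\<And>k. k < d \<Longrightarrow> mat_linear s s p q (F k)"
    and X: "\<And>k. k < d \<Longrightarrow> X k \<in> carrier_mat (s * m) (s * n)"
    and Z: "\<And>k. k < d \<Longrightarrow> Z k \<in> carrier_mat (s * m) (s * n')"
    and X': "\<And>k. k < d \<Longrightarrow> X' k \<in> carrier_mat (s * m') (s * n')"
  shows "blockwise_sum s p q d F (m + m') (n + n')
      (\<lambda>k. four_block_mat (X k) (Z k) (0\<^sub>m (s * m') (s * n)) (X' k)) =
    four_block_mat (blockwise_sum s p q d F m n X) (blockwise_sum s p q d F m n' Z)
      (0\<^sub>m (p * m') (q * n)) (blockwise_sum s p q d F m' n' X')"
proof -
  note bc = blockwise_carrier[OF s]
  have "blockwise_sum s p q d F (m + m') (n + n')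
      (\<lambda>k. four_block_mat (X k) (Z k) (0\<^sub>m (s * m') (s * n)) (X' k)) =
    mat_sum (p * m + p * m') (q * n + q * n') d (\<lambda>k. four_block_mat (blockwise s p q (F k) (X k))
      (blockwise s p q (F k) (Z k)) (blockwise s p q (F k) (0\<^sub>m (s * m') (s * n))) (blockwise s p q (F k) (X' k)))"
    unfolding blockwise_sum_def distrib_left
    by (intro mat_sum_cong blockwise_four_block_mat[OF s F X Z zero_carrier_mat X'])
  also have "\<dots> = four_block_mat (blockwise_sum s p q d F m n X) (blockwise_sum s p q d F m n' Z)
      (blockwise_sum s p q d F m' n (\<lambda>k. 0\<^sub>m (s * m') (s * n))) (blockwise_sum s p q d F m' n' X')"
    unfolding blockwise_sum_def by (rule mat_sum_four_block_mat[OF bc[OF X] bc[OF X']])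
  also have "blockwise_sum s p q d F m' n (\<lambda>k. 0\<^sub>m (s * m') (s * n)) = 0\<^sub>m (p * m') (q * n)"
    by (rule blockwise_sum_zero[OF s F])
  finally show ?thesis .
qed

section \<open>Direct sums of matrices\<close>

lemma direct_sum_eq:
  assumes "X \<in> carrier_mat m n" "X' \<in> carrier_mat m' n'"
  shows "direct_sum X X' = four_block_mat X (0\<^sub>m m n') (0\<^sub>m m' n) X'"
  using assms by (auto simp: direct_sum_def)

lemma direct_sum_carrier:
  "X \<in> carrier_mat m n \<Longrightarrow> X' \<in> carrier_mat m' n' \<Longrightarrow> direct_sum X X' \<in> carrier_mat (m + m') (n + n')"
  by (simp add: direct_sum_eq)

lemma direct_sum_mult:
  assumes "X \<in> carrier_mat m n" "X' \<in> carrier_mat m' n'" "Z \<in> carrier_mat n l" "Z' \<in> carrier_mat n' l'"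
  shows "direct_sum X X' * direct_sum Z Z' = direct_sum (X * Z) (X' * Z')"
proof -
  have XZ: "X * Z \<in> carrier_mat m l" "X' * Z' \<in> carrier_mat m' l'" using assms by auto
  show ?thesis
    unfolding direct_sum_eq[OF assms(1,2)] direct_sum_eq[OF assms(3,4)] direct_sum_eq[OF XZ]
    using assms XZ by (subst mult_four_block_mat) auto
qed

lemma direct_sum_add:
  assumes "X \<in> carrier_mat m n" "X' \<in> carrier_mat m' n'" "Z \<in> carrier_mat m n" "Z' \<in> carrier_mat m' n'"
  shows "direct_sum X X' + direct_sum Z Z' = direct_sum (X + Z) (X' + Z')"
  using assms by (intro eq_matI) (auto simp: direct_sum_def)

lemma direct_sum_one: "direct_sum (1\<^sub>m n) (1\<^sub>m n') = 1\<^sub>m (n + n')"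
  by (simp add: direct_sum_def)

lemma mat_inv_direct_sum:
  assumes X: "X \<in> carrier_mat n n" "det X \<noteq> 0" and X': "X' \<in> carrier_mat n' n'" "det X' \<noteq> 0"
  shows "mat_inv (direct_sum X X') = direct_sum (mat_inv X) (mat_inv X')"
proof (rule mat_inv_unique)
  show "direct_sum X X' * direct_sum (mat_inv X) (mat_inv X') = 1\<^sub>m (n + n')"
    using direct_sum_mult[OF X(1) X'(1) mat_inv(1)[OF X] mat_inv(1)[OF X']]
    by (simp add: mat_inv(2)[OF X] mat_inv(2)[OF X'] direct_sum_one)
qed (intro direct_sum_carrier X X' mat_inv(1)[OF X] mat_inv(1)[OF X'])+

lemma mat_tuples_nth: "X \<in> mat_tuples d n m \<Longrightarrow> k < d \<Longrightarrow> X ! k \<in> carrier_mat n m"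
  by (auto simp: mat_tuples_def)

lemma mat_tuplesI:
  "length X = d \<Longrightarrow> (\<And>k. k < d \<Longrightarrow> X ! k \<in> carrier_mat n m) \<Longrightarrow> X \<in> mat_tuples d n m"
  by (auto simp: mat_tuples_def in_set_conv_nth)

section \<open>Realizations\<close>

definition shift :: "'a::field mat list \<Rightarrow> nat \<Rightarrow> 'a mat list \<Rightarrow> nat \<Rightarrow> 'a mat" where
  "shift Y m X k = X ! k - kron (1\<^sub>m m) (Y ! k)"

text \<open>I \<otimes> M has zero off-diagonal corners, so subtracting the centre leaves Z as it
  is.\<close>

lemma shift_four_block_mat:
  assumes X: "X \<in> carrier_mat (s * m) (s * m)" and Z: "Z \<in> carrier_mat (s * m) (s * m')"
    and X': "X' \<in> carrier_mat (s * m') (s * m')" and M: "M \<in> carrier_mat s s"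
  shows "four_block_mat X Z (0\<^sub>m (s * m') (s * m)) X' - kron (1\<^sub>m (m + m')) M =
    four_block_mat (X - kron (1\<^sub>m m) M) Z (0\<^sub>m (s * m') (s * m)) (X' - kron (1\<^sub>m m') M)"
proof -
  note kc = kron_one_carrier[OF M]
  have "Z - 0\<^sub>m (s * m) (s * m') = Z" using Z by (intro eq_matI) auto
  then show ?thesis
    unfolding kron_one_four_block_mat[OF M]
      minus_four_block_mat[OF X Z zero_carrier_mat X' kc zero_carrier_mat zero_carrier_mat kc]
    by simp
qed

locale lost_abbey_realization =
  fixes s d L :: nat
    and D C :: "'a::field mat"
    and A B :: "nat \<Rightarrow> 'a mat \<Rightarrow> 'a mat"
    and Y :: "'a mat list"
  assumes s: "s \<ge> 1" and d: "d \<ge> 1"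
    and realization: "fm_realization s d L D C A B Y"
    and lost_abbey: "linearized_lost_abbey s d L D C A B Y"
begin

lemma A: "k < d \<Longrightarrow> mat_linear s s L L (A k)" and B: "k < d \<Longrightarrow> mat_linear s s L s (B k)"
  and C: "C \<in> carrier_mat s L" and D: "D \<in> carrier_mat s s" and Y: "Y \<in> mat_tuples d s s"
  using realization by (auto simp: fm_realization_def)

lemma Y_nth: "k < d \<Longrightarrow> Y ! k \<in> carrier_mat s s"
  by (rule mat_tuples_nth[OF Y])

abbreviation "P \<equiv> commutator_sum L L d A Y"
abbreviation "Q \<equiv> commutator_sum L s d B Y"

lemma P: "mat_linear s s L L P" and Q: "mat_linear s s L s Q"
  by (rule mat_linear_commutator_sum[OF Y_nth A] mat_linear_commutator_sum[OF Y_nth B]; simp)+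

context
  fixes S Z Z' :: "'a mat" and i j :: nat
  assumes S: "S \<in> carrier_mat s s" and Z: "Z \<in> carrier_mat s s" and Z': "Z' \<in> carrier_mat s s"
    and i: "i < d" and j: "j < d"
begin

text \<open>Differences are turned into sums, and the identities beginning with C or D are
  multiplied on the left by Z. In this form all six match the premise \<open>eq\<close> of the block
  extension lemmas.\<close>

lemma lost_abbey_D: "(Z * S) * D = Z * D * S + Z * C * Q S"
  and lost_abbey_CB: "Z * S * C * B j Z' = Z * C * (B j (S * Z') + P S * B j Z')"
  and lost_abbey_CA: "Z * S * C * A j Z' = Z * C * (A j (S * Z') + P S * A j Z')"
  and lost_abbey_B: "B i (Z * S) = B i Z * S + A i Z * Q S"
  and lost_abbey_AB: "A i (Z * S) * B j Z' = A i Z * (B j (S * Z') + P S * B j Z')"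
  and lost_abbey_AA: "A i (Z * S) * A j Z' = A i Z * (A j (S * Z') + P S * A j Z')"
proof -
  have ZS: "Z * S \<in> carrier_mat s s" and SZ': "S * Z' \<in> carrier_mat s s" using S Z Z' by auto
  have cP: "P S \<in> carrier_mat L L" and cQ: "Q S \<in> carrier_mat L s"
    by (simp_all add: commutator_sum_def)
  have cA: "A i (Z * S) \<in> carrier_mat L L" "A i Z \<in> carrier_mat L L"
    "A j (S * Z') \<in> carrier_mat L L" "A j Z' \<in> carrier_mat L L"
    by (rule mat_linear_carrier[OF A] i j Z Z' ZS SZ')+
  have cB: "B i (Z * S) \<in> carrier_mat L s" "B i Z \<in> carrier_mat L s"
    "B j (S * Z') \<in> carrier_mat L s" "B j Z' \<in> carrier_mat L s"
    by (rule mat_linear_carrier[OF B] i j Z Z' ZS SZ')+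
  note carrier = S Z Z' C D cP cQ cA cB
  note dims = carrier[THEN carrier_matD(1)] carrier[THEN carrier_matD(2)]
  note la = lost_abbey[unfolded linearized_lost_abbey_def Let_def, folded commutator_sum_def, rule_format]
  \<comment> \<open>In the conditions led by C the first matrix variable stands in the right factor,
    hence is Z' with index j; in those led by A or B it is the left argument Z with index i.\<close>
  note la1 = la[OF S Z' Z' j j] and la2 = la[OF S Z Z' i j]
  have "S * D = D * S + C * Q S"
    by (rule mat_eq_add_if_minus_eq[of _ _ _ s s]) (use la1 carrier in auto)
  then have "Z * (S * D) = Z * (D * S + C * Q S)" by simp
  then show "(Z * S) * D = Z * D * S + Z * C * Q S" by (simp add: mat_algebra_dim dims)
  have "S * C * B j Z' = C * B j (S * Z') + C * P S * B j Z'"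
    by (rule mat_eq_add_if_minus_eq[of _ _ _ s s]) (use la1 carrier in auto)
  then have "Z * (S * C * B j Z') = Z * (C * B j (S * Z') + C * P S * B j Z')" by simp
  then show "Z * S * C * B j Z' = Z * C * (B j (S * Z') + P S * B j Z')"
    by (simp add: mat_algebra_dim dims)
  have "S * C * A j Z' = C * A j (S * Z') + C * P S * A j Z'"
    by (rule mat_eq_add_if_minus_eq[of _ _ _ s L]) (use la1 carrier in auto)
  then have "Z * (S * C * A j Z') = Z * (C * A j (S * Z') + C * P S * A j Z')" by simp
  then show "Z * S * C * A j Z' = Z * C * (A j (S * Z') + P S * A j Z')"
    by (simp add: mat_algebra_dim dims)
  show "B i (Z * S) = B i Z * S + A i Z * Q S"
    by (rule mat_eq_add_if_minus_eq[of _ _ _ L s]) (use la2 carrier in auto)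
  have "A i (Z * S) * B j Z' = A i Z * B j (S * Z') + A i Z * P S * B j Z'"
    by (rule mat_eq_add_if_minus_eq[of _ _ _ L s]) (use la2 carrier in auto)
  then show "A i (Z * S) * B j Z' = A i Z * (B j (S * Z') + P S * B j Z')"
    by (simp add: mat_algebra_dim dims)
  have "A i (Z * S) * A j Z' = A i Z * A j (S * Z') + A i Z * P S * A j Z'"
    by (rule mat_eq_add_if_minus_eq[of _ _ _ L L]) (use la2 carrier in auto)
  then show "A i (Z * S) * A j Z' = A i Z * (A j (S * Z') + P S * A j Z')"
    by (simp add: mat_algebra_dim dims)
qed

end

section \<open>The transfer function and its intertwining property\<close>

abbreviation "\<alpha> m X \<equiv> blockwise_sum s L L d A m m (shift Y m X)"
abbreviation "\<beta> m X \<equiv> blockwise_sum s L s d B m m (shift Y m X)"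

lemma fm_Lambda_eq: "fm_Lambda s d L A Y m X = 1\<^sub>m (L * m) - \<alpha> m X"
  by (simp add: fm_Lambda_def blockwise_sum_def shift_def)

lemma fm_Lambda_carrier: "fm_Lambda s d L A Y m X \<in> carrier_mat (L * m) (L * m)"
  by (simp add: fm_Lambda_eq minus_carrier_mat)

text \<open>The coordinate with index 0 exists as d \<ge> 1; its size is s * m, and s \<ge> 1 allows
  m to be recovered by division.\<close>

lemma fm_function_eq:
  assumes "X \<in> mat_tuples d (s * m) (s * m)"
  shows "fm_function s d L D C A B Y X =
    kron (1\<^sub>m m) D + kron (1\<^sub>m m) C * mat_inv (fm_Lambda s d L A Y m X) * \<beta> m X"
proof -
  have "dim_row (X ! 0) div s = m" using mat_tuples_nth[OF assms, of 0] s d by simp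
  then show ?thesis by (simp add: fm_function_def Let_def blockwise_sum_def shift_def)
qed

lemma shift_carrier:
  "X \<in> mat_tuples d (s * m) (s * m) \<Longrightarrow> k < d \<Longrightarrow> shift Y m X k \<in> carrier_mat (s * m) (s * m)"
  unfolding shift_def by (rule minus_carrier_mat[OF kron_one_carrier[OF Y_nth]])

text \<open>An instance of \<open>resolvent_intertwining\<close> whose six premises about T are the
  block forms of the six conditions at S = T. The left argument is the identity for those led by C
  or D and a shifted coordinate of X' for the others; the right argument, where there is one, is a
  shifted coordinate of X.\<close>

lemma fm_function_intertwining:
  assumes X: "X \<in> fm_domain_at s d L A Y m" and X': "X' \<in> fm_domain_at s d L A Y m"
    and T: "T \<in> carrier_mat (s * m) (s * m)" and TX: "\<And>k. k < d \<Longrightarrow> T * X ! k = X' ! k * T"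
  shows "T * fm_function s d L D C A B Y X = fm_function s d L D C A B Y X' * T"
proof -
  have tX: "X \<in> mat_tuples d (s * m) (s * m)" and dX: "det (fm_Lambda s d L A Y m X) \<noteq> 0"
    and tX': "X' \<in> mat_tuples d (s * m) (s * m)" and dX': "det (fm_Lambda s d L A Y m X') \<noteq> 0"
    using X X' by (auto simp: fm_domain_at_def)
  note W = shift_carrier[OF tX] and W' = shift_carrier[OF tX']
  have TW: "T * shift Y m X k \<in> carrier_mat (s * m) (s * m)" if "k < d" for k
    using T W[OF that] by simp
  let ?V = "\<lambda>k. T * kron (1\<^sub>m m) (Y ! k) - kron (1\<^sub>m m) (Y ! k) * T"
  have V: "?V k \<in> carrier_mat (s * m) (s * m)" if "k < d" for k
    by (rule minus_carrier_mat[OF mult_carrier_mat[OF kron_one_carrier[OF Y_nth[OF that]] T]])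
  \<comment> \<open>T intertwines X with X', but it need not commute with I \<otimes> Y_k:
    subtracting the centre leaves the commutator of T and I \<otimes> Y_k as a defect. This is where
    the commutators of the conditions come from.\<close>
  have W'T: "shift Y m X' k * T = T * shift Y m X k + ?V k" if k: "k < d" for k
  proof -
    note Yk = kron_one_carrier[OF Y_nth[OF k], of m]
    have "shift Y m X' k * T = T * X ! k - kron (1\<^sub>m m) (Y ! k) * T"
      unfolding shift_def minus_mult_distrib_mat[OF mat_tuples_nth[OF tX' k] Yk T] TX[OF k] ..
    moreover have "T * shift Y m X k = T * X ! k - T * kron (1\<^sub>m m) (Y ! k)"
      unfolding shift_def by (rule mult_minus_distrib_mat[OF T mat_tuples_nth[OF tX k] Yk])
    ultimately show ?thesis
      using T mat_tuples_nth[OF tX k] Yk by (simp only:) (intro eq_matI; auto)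
  qed
  let ?E = "blockwise_sum s L L d A m m (\<lambda>k. T * shift Y m X k)"
  let ?F = "blockwise_sum s L s d B m m (\<lambda>k. T * shift Y m X k)"
  let ?P = "blockwise s L L P T" and ?Q = "blockwise s L s Q T"
  \<comment> \<open>By linearity the defect splits off as the extension of P at T. Thus E + P is the
    sum of the A_k at products ending in T, as the left side A_i(Z S) of the conditions
    demands.\<close>
  have EP: "blockwise_sum s L L d A m m (\<lambda>k. shift Y m X' k * T) = ?E + ?P"
  proof -
    have "blockwise_sum s L L d A m m (\<lambda>k. shift Y m X' k * T)
        = blockwise_sum s L L d A m m (\<lambda>k. T * shift Y m X k + ?V k)"
      by (rule blockwise_sum_cong[OF W'T])
    also have "\<dots> = ?E + blockwise_sum s L L d A m m ?V" by (rule blockwise_sum_add[OF s A TW V])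
    also have "blockwise_sum s L L d A m m ?V = ?P"
      by (rule blockwise_commutator_sum[OF s Y_nth A T, symmetric])
    finally show ?thesis .
  qed
  have FQ: "blockwise_sum s L s d B m m (\<lambda>k. shift Y m X' k * T) = ?F + ?Q"
  proof -
    have "blockwise_sum s L s d B m m (\<lambda>k. shift Y m X' k * T)
        = blockwise_sum s L s d B m m (\<lambda>k. T * shift Y m X k + ?V k)"
      by (rule blockwise_sum_cong[OF W'T])
    also have "\<dots> = ?F + blockwise_sum s L s d B m m ?V" by (rule blockwise_sum_add[OF s B TW V])
    also have "blockwise_sum s L s d B m m ?V = ?Q"
      by (rule blockwise_commutator_sum[OF s Y_nth B T, symmetric])
    finally show ?thesis .
  qed
  have one: "1\<^sub>m (s * m) \<in> carrier_mat (s * m) (s * m)" by simp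
  \<comment> \<open>The factor 1 in front of T is kept so that the argument has the form Z * S of
    the block extension lemmas.\<close>
  have Ckron: "blockwise s s L (\<lambda>Z. Z * C) (1\<^sub>m (s * m)) = kron (1\<^sub>m m) C"
    "blockwise s s L (\<lambda>Z. Z * C) (1\<^sub>m (s * m) * T) = T * kron (1\<^sub>m m) C"
    using blockwise_mult_const[OF s one C] blockwise_mult_const[OF s T C] kron_one_carrier[OF C, of m] T
    by simp_all
  have Dkron: "blockwise s s s (\<lambda>Z. Z * D) (1\<^sub>m (s * m)) = kron (1\<^sub>m m) D"
    "blockwise s s s (\<lambda>Z. Z * D) (1\<^sub>m (s * m) * T) = T * kron (1\<^sub>m m) D"
    using blockwise_mult_const[OF s one D] blockwise_mult_const[OF s T D] kron_one_carrier[OF D, of m] T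
    by simp_all
  note linC = mat_linear_mult_right[OF C, of s] and linD = mat_linear_mult_right[OF D, of s]
  have "T * (kron (1\<^sub>m m) D + kron (1\<^sub>m m) C * mat_inv (fm_Lambda s d L A Y m X) * \<beta> m X)
      = (kron (1\<^sub>m m) D + kron (1\<^sub>m m) C * mat_inv (fm_Lambda s d L A Y m X') * \<beta> m X') * T"
  proof (rule resolvent_intertwining[of "\<alpha> m X" "L * m" "\<alpha> m X'" ?E ?P _ "s * m" _ ?F ?Q])
    show "?P \<in> carrier_mat (L * m) (L * m)" "?Q \<in> carrier_mat (L * m) (s * m)"
      by (rule blockwise_carrier[OF s T])+
    show "mat_inv (fm_Lambda s d L A Y m X) \<in> carrier_mat (L * m) (L * m)"
      "mat_inv (fm_Lambda s d L A Y m X') \<in> carrier_mat (L * m) (L * m)"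
      by (rule mat_inv(1)[OF fm_Lambda_carrier] dX dX')+
    show "(1\<^sub>m (L * m) - \<alpha> m X) * mat_inv (fm_Lambda s d L A Y m X) = 1\<^sub>m (L * m)"
      unfolding fm_Lambda_eq[symmetric] by (rule mat_inv(2)[OF fm_Lambda_carrier dX])
    show "mat_inv (fm_Lambda s d L A Y m X') * (1\<^sub>m (L * m) - \<alpha> m X') = 1\<^sub>m (L * m)"
      unfolding fm_Lambda_eq[symmetric] by (rule mat_inv(3)[OF fm_Lambda_carrier dX'])
    show "T * kron (1\<^sub>m m) D = kron (1\<^sub>m m) D * T + kron (1\<^sub>m m) C * ?Q"
    proof -
      have "blockwise s s s (\<lambda>Z. Z * D) (1\<^sub>m (s * m) * T)
          = blockwise s s s (\<lambda>Z. Z * D) (1\<^sub>m (s * m)) * T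
            + blockwise s s L (\<lambda>Z. Z * C) (1\<^sub>m (s * m)) * ?Q"
        \<comment> \<open>\<open>Z'\<close>, \<open>i\<close> and \<open>j\<close> are parameters of
          the context that the D-identity does not mention; 0 is an admissible index as d \<ge>
          1.\<close>
        by (rule blockwise_mult_right[OF s one T linD linC Q], rule lost_abbey_D[where Z' = "1\<^sub>m s" and i = 0 and j = 0])
          (use d in simp_all)
      then show ?thesis unfolding Ckron Dkron .
    qed
    show "T * kron (1\<^sub>m m) C * \<beta> m X = kron (1\<^sub>m m) C * (?F + ?P * \<beta> m X)"
    proof -
      have "blockwise s s L (\<lambda>Z. Z * C) (1\<^sub>m (s * m) * T) * \<beta> m X
          = blockwise s s L (\<lambda>Z. Z * C) (1\<^sub>m (s * m)) * (?F + ?P * \<beta> m X)"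
        by (rule blockwise_mult_sum_middle[OF s one T W linC B P lost_abbey_CB])
      then show ?thesis unfolding Ckron .
    qed
    show "T * kron (1\<^sub>m m) C * \<alpha> m X = kron (1\<^sub>m m) C * (?E + ?P * \<alpha> m X)"
    proof -
      have "blockwise s s L (\<lambda>Z. Z * C) (1\<^sub>m (s * m) * T) * \<alpha> m X
          = blockwise s s L (\<lambda>Z. Z * C) (1\<^sub>m (s * m)) * (?E + ?P * \<alpha> m X)"
        by (rule blockwise_mult_sum_middle[OF s one T W linC A P lost_abbey_CA])
      then show ?thesis unfolding Ckron .
    qed
    show "?F + ?Q = \<beta> m X' * T + \<alpha> m X' * ?Q"
      unfolding FQ[symmetric] by (rule blockwise_sum_mult_right[OF s W' T B A Q lost_abbey_B])
    show "(?E + ?P) * \<beta> m X = \<alpha> m X' * (?F + ?P * \<beta> m X)"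
      unfolding EP[symmetric] by (rule blockwise_sum_mult_middle[OF s W' T W A B P lost_abbey_AB])
    show "(?E + ?P) * \<alpha> m X = \<alpha> m X' * (?E + ?P * \<alpha> m X)"
      unfolding EP[symmetric] by (rule blockwise_sum_mult_middle[OF s W' T W A A P lost_abbey_AA])
  qed (simp_all add: T kron_one_carrier[OF C] kron_one_carrier[OF D])
  then show ?thesis unfolding fm_function_eq[OF tX] fm_function_eq[OF tX'] .
qed

section \<open>Block triangular points and direct sums\<close>

lemma blockwise_sum_shift_upper:
  assumes X: "X \<in> mat_tuples d (s * m) (s * m)" and X': "X' \<in> mat_tuples d (s * m') (s * m')"
    and Z: "\<And>k. k < d \<Longrightarrow> Z k \<in> carrier_mat (s * m) (s * m')"
    and U: "\<And>k. k < d \<Longrightarrow> U ! k = four_block_mat (X ! k) (Z k) (0\<^sub>m (s * m') (s * m)) (X' ! k)"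
    and F: "\<And>k. k < d \<Longrightarrow> mat_linear s s p q (F k)"
  shows "blockwise_sum s p q d F (m + m') (m + m') (shift Y (m + m') U) =
    four_block_mat (blockwise_sum s p q d F m m (shift Y m X)) (blockwise_sum s p q d F m m' Z)
      (0\<^sub>m (p * m') (q * m)) (blockwise_sum s p q d F m' m' (shift Y m' X'))"
proof -
  have "shift Y (m + m') U k = four_block_mat (shift Y m X k) (Z k) (0\<^sub>m (s * m') (s * m)) (shift Y m' X' k)"
    if k: "k < d" for k
    unfolding shift_def U[OF k]
    by (rule shift_four_block_mat[OF mat_tuples_nth[OF X k] Z[OF k] mat_tuples_nth[OF X' k] Y_nth[OF k]])
  then have "blockwise_sum s p q d F (m + m') (m + m') (shift Y (m + m') U) =
      blockwise_sum s p q d F (m + m') (m + m')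
        (\<lambda>k. four_block_mat (shift Y m X k) (Z k) (0\<^sub>m (s * m') (s * m)) (shift Y m' X' k))"
    by (rule blockwise_sum_cong)
  also have "\<dots> = four_block_mat (blockwise_sum s p q d F m m (shift Y m X)) (blockwise_sum s p q d F m m' Z)
      (0\<^sub>m (p * m') (q * m)) (blockwise_sum s p q d F m' m' (shift Y m' X'))"
    by (rule blockwise_sum_four_block_mat[OF s F shift_carrier[OF X] Z shift_carrier[OF X']])
  finally show ?thesis .
qed

lemma fm_Lambda_upper:
  assumes X: "X \<in> mat_tuples d (s * m) (s * m)" and X': "X' \<in> mat_tuples d (s * m') (s * m')"
    and Z: "\<And>k. k < d \<Longrightarrow> Z k \<in> carrier_mat (s * m) (s * m')"
    and U: "\<And>k. k < d \<Longrightarrow> U ! k = four_block_mat (X ! k) (Z k) (0\<^sub>m (s * m') (s * m)) (X' ! k)"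
  shows "fm_Lambda s d L A Y (m + m') U = four_block_mat (fm_Lambda s d L A Y m X)
    (0\<^sub>m (L * m) (L * m') - blockwise_sum s L L d A m m' Z) (0\<^sub>m (L * m') (L * m)) (fm_Lambda s d L A Y m' X')"
proof -
  have one: "1\<^sub>m (L * (m + m')) = four_block_mat (1\<^sub>m (L * m)) (0\<^sub>m (L * m) (L * m'))
      (0\<^sub>m (L * m') (L * m)) (1\<^sub>m (L * m') :: 'a mat)"
    by (simp add: distrib_left)
  have \<alpha>: "\<alpha> (m + m') U = four_block_mat (\<alpha> m X) (blockwise_sum s L L d A m m' Z)
      (0\<^sub>m (L * m') (L * m)) (\<alpha> m' X')"
    by (rule blockwise_sum_shift_upper[OF X X' Z U A])
  show ?thesis
    unfolding fm_Lambda_eq one \<alpha>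
    by (subst minus_four_block_mat[of _ "L * m" "L * m" _ "L * m'" _ "L * m'"]) simp_all
qed

text \<open>The corner Z does not enter the determinant, so one statement serves twice: with Z = 0
  for direct sums and with the prescribed Z for upper admissibility.\<close>

lemma upper_in_fm_domain_at:
  assumes X: "X \<in> fm_domain_at s d L A Y m" and X': "X' \<in> fm_domain_at s d L A Y m'"
    and Z: "\<And>k. k < d \<Longrightarrow> Z k \<in> carrier_mat (s * m) (s * m')" and "length U = d"
    and U: "\<And>k. k < d \<Longrightarrow> U ! k = four_block_mat (X ! k) (Z k) (0\<^sub>m (s * m') (s * m)) (X' ! k)"
  shows "U \<in> fm_domain_at s d L A Y (m + m')"
proof -
  have tX: "X \<in> mat_tuples d (s * m) (s * m)" and tX': "X' \<in> mat_tuples d (s * m') (s * m')"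
    and det: "det (fm_Lambda s d L A Y m X) \<noteq> 0" "det (fm_Lambda s d L A Y m' X') \<noteq> 0"
    using X X' by (auto simp: fm_domain_at_def)
  have "U ! k \<in> carrier_mat (s * (m + m')) (s * (m + m'))" if "k < d" for k
    unfolding U[OF that] distrib_left
    by (rule four_block_carrier_mat[OF mat_tuples_nth[OF tX that] mat_tuples_nth[OF tX' that]])
  then have tU: "U \<in> mat_tuples d (s * (m + m')) (s * (m + m'))"
    using \<open>length U = d\<close> by (intro mat_tuplesI)
  have \<Lambda>: "fm_Lambda s d L A Y (m + m') U = four_block_mat (fm_Lambda s d L A Y m X)
      (0\<^sub>m (L * m) (L * m') - blockwise_sum s L L d A m m' Z) (0\<^sub>m (L * m') (L * m)) (fm_Lambda s d L A Y m' X')"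
    by (rule fm_Lambda_upper[OF tX tX' Z U])
  have "det (fm_Lambda s d L A Y (m + m') U)
      = det (fm_Lambda s d L A Y m X) * det (fm_Lambda s d L A Y m' X')"
    unfolding \<Lambda>
    by (rule det_four_block_mat_lower_left_zero[OF fm_Lambda_carrier _ refl fm_Lambda_carrier])
      (simp add: minus_carrier_mat)
  then show ?thesis using det tU by (simp add: fm_domain_at_def)
qed

lemma direct_sum_in_fm_domain_at:
  assumes X: "X \<in> fm_domain_at s d L A Y m" and X': "X' \<in> fm_domain_at s d L A Y m'"
  shows "tuple_direct_sum X X' \<in> fm_domain_at s d L A Y (m + m')"
    and "k < d \<Longrightarrow> tuple_direct_sum X X' ! k
      = four_block_mat (X ! k) (0\<^sub>m (s * m) (s * m')) (0\<^sub>m (s * m') (s * m)) (X' ! k)"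
proof -
  have tX: "X \<in> mat_tuples d (s * m) (s * m)" and tX': "X' \<in> mat_tuples d (s * m') (s * m')"
    using X X' by (auto simp: fm_domain_at_def)
  have len: "length X = d" "length X' = d" using tX tX' by (auto simp: mat_tuples_def)
  show nth: "tuple_direct_sum X X' ! k
      = four_block_mat (X ! k) (0\<^sub>m (s * m) (s * m')) (0\<^sub>m (s * m') (s * m)) (X' ! k)" if "k < d" for k
    using len that direct_sum_eq[OF mat_tuples_nth[OF tX that] mat_tuples_nth[OF tX' that]]
    by (simp add: tuple_direct_sum_def)
  show "tuple_direct_sum X X' \<in> fm_domain_at s d L A Y (m + m')"
    by (rule upper_in_fm_domain_at[OF X X' zero_carrier_mat _ nth]) (simp_all add: tuple_direct_sum_def len)
qed

text \<open>Every factor of the formula is a direct sum, the pieces have matching sizes, and sums,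
  products and inverses of direct sums are taken summand by summand.\<close>

lemma fm_function_direct_sum:
  assumes X: "X \<in> fm_domain_at s d L A Y m" and X': "X' \<in> fm_domain_at s d L A Y m'"
  shows "fm_function s d L D C A B Y (tuple_direct_sum X X') =
    direct_sum (fm_function s d L D C A B Y X) (fm_function s d L D C A B Y X')"
proof -
  have tX: "X \<in> mat_tuples d (s * m) (s * m)" and tX': "X' \<in> mat_tuples d (s * m') (s * m')"
    and dX: "det (fm_Lambda s d L A Y m X) \<noteq> 0" and dX': "det (fm_Lambda s d L A Y m' X') \<noteq> 0"
    using X X' by (auto simp: fm_domain_at_def)
  let ?U = "tuple_direct_sum X X'"
  have tU: "?U \<in> mat_tuples d (s * (m + m')) (s * (m + m'))"
    using direct_sum_in_fm_domain_at(1)[OF X X'] by (simp add: fm_domain_at_def)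
  note nth = direct_sum_in_fm_domain_at(2)[OF X X']
  \<comment> \<open>The triangular formula at Z = 0, where the corner of \<Lambda> vanishes by
    linearity of the A_k.\<close>
  have \<Lambda>: "fm_Lambda s d L A Y (m + m') ?U = direct_sum (fm_Lambda s d L A Y m X) (fm_Lambda s d L A Y m' X')"
    using fm_Lambda_upper[OF tX tX' zero_carrier_mat nth]
    by (simp add: blockwise_sum_zero[OF s A] direct_sum_eq[OF fm_Lambda_carrier fm_Lambda_carrier])
  have \<beta>: "\<beta> (m + m') ?U = direct_sum (\<beta> m X) (\<beta> m' X')"
    using blockwise_sum_shift_upper[OF tX tX' zero_carrier_mat nth B]
    by (simp add: blockwise_sum_zero[OF s B] direct_sum_eq[OF blockwise_sum_carrier blockwise_sum_carrier])
  have kron: "kron (1\<^sub>m (m + m')) M = direct_sum (kron (1\<^sub>m m) M) (kron (1\<^sub>m m') M)"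
    if "M \<in> carrier_mat p q" for M :: "'a mat" and p q
    unfolding kron_one_four_block_mat[OF that]
    by (rule direct_sum_eq[OF kron_one_carrier[OF that] kron_one_carrier[OF that], symmetric])
  note kC = kron_one_carrier[OF C] and kD = kron_one_carrier[OF D]
  note inv = mat_inv(1)[OF fm_Lambda_carrier dX] and inv' = mat_inv(1)[OF fm_Lambda_carrier dX']
  note CI = mult_carrier_mat[OF kC inv] and CI' = mult_carrier_mat[OF kC inv']
  show ?thesis
    unfolding fm_function_eq[OF tX] fm_function_eq[OF tX'] fm_function_eq[OF tU] \<Lambda> \<beta> kron[OF C] kron[OF D]
      mat_inv_direct_sum[OF fm_Lambda_carrier dX fm_Lambda_carrier dX'] direct_sum_mult[OF kC kC inv inv']
      direct_sum_mult[OF CI CI' blockwise_sum_carrier blockwise_sum_carrier]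
    by (rule direct_sum_add[OF kD kD mult_carrier_mat[OF CI blockwise_sum_carrier]
          mult_carrier_mat[OF CI' blockwise_sum_carrier]])
qed

section \<open>Levels of the domain and the nc properties\<close>

lemma nc_level_fm_domainE:
  assumes "X \<in> nc_level d (fm_domain s d L A Y) n"
  obtains m where "m \<ge> 1" "n = s * m" "X \<in> fm_domain_at s d L A Y m"
proof -
  from assms obtain m where m: "m \<ge> 1" "X \<in> fm_domain_at s d L A Y m" "X \<in> mat_tuples d n n"
    by (auto simp: nc_level_def fm_domain_def)
  then have "X \<in> mat_tuples d (s * m) (s * m)" by (simp add: fm_domain_at_def)
  \<comment> \<open>Both numbers are the row number of the coordinate with index 0, which exists as
    d \<ge> 1.\<close>
  then have "n = s * m"
    using mat_tuples_nth[OF m(3), of 0] mat_tuples_nth[of X d "s * m" "s * m" 0] d by auto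
  then show thesis using that m by blast
qed

lemma nc_level_fm_domainI:
  "m \<ge> 1 \<Longrightarrow> X \<in> fm_domain_at s d L A Y m \<Longrightarrow> X \<in> nc_level d (fm_domain s d L A Y) (s * m)"
  by (auto simp: nc_level_def fm_domain_def fm_domain_at_def)

lemma nc_set_fm_domain: "nc_set d (fm_domain s d L A Y)"
  unfolding nc_set_def
proof (intro conjI ballI)
  show "fm_domain s d L A Y \<subseteq> nc_space d"
    using s by (fastforce simp: fm_domain_def fm_domain_at_def nc_space_def)
  fix X X' assume "X \<in> fm_domain s d L A Y" "X' \<in> fm_domain s d L A Y"
  then obtain m m' where "m \<ge> 1" "X \<in> fm_domain_at s d L A Y m" "X' \<in> fm_domain_at s d L A Y m'"
    by (auto simp: fm_domain_def)
  then have "m + m' \<in> {1..}" "tuple_direct_sum X X' \<in> fm_domain_at s d L A Y (m + m')"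
    using direct_sum_in_fm_domain_at(1) by auto
  then show "tuple_direct_sum X X' \<in> fm_domain s d L A Y" unfolding fm_domain_def by blast
qed

lemma upper_admissible_fm_domain: "upper_admissible d (fm_domain s d L A Y)"
  unfolding upper_admissible_def
proof (intro allI ballI)
  fix n n' X X' and Z :: "'a mat list"
  assume X: "X \<in> nc_level d (fm_domain s d L A Y) n" and X': "X' \<in> nc_level d (fm_domain s d L A Y) n'"
    and Z: "Z \<in> mat_tuples d n n'"
  obtain m where m: "m \<ge> 1" "n = s * m" "X \<in> fm_domain_at s d L A Y m"
    using X by (rule nc_level_fm_domainE)
  obtain m' where m': "m' \<ge> 1" "n' = s * m'" "X' \<in> fm_domain_at s d L A Y m'"
    using X' by (rule nc_level_fm_domainE)
  have tX: "X \<in> mat_tuples d (s * m) (s * m)" and tX': "X' \<in> mat_tuples d (s * m') (s * m')"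
    using m m' by (auto simp: fm_domain_at_def)
  have len: "length X = d" using tX by (simp add: mat_tuples_def)
  have "tuple_upper X 1 Z X' \<in> fm_domain_at s d L A Y (m + m')"
  proof (rule upper_in_fm_domain_at[OF m(3) m'(3)])
    show "length (tuple_upper X 1 Z X') = d" by (simp add: tuple_upper_def len)
    fix k assume k: "k < d"
    show "1 \<cdot>\<^sub>m Z ! k \<in> carrier_mat (s * m) (s * m')"
      using mat_tuples_nth[OF Z k] m(2) m'(2) by simp
    show "tuple_upper X 1 Z X' ! k
        = four_block_mat (X ! k) (1 \<cdot>\<^sub>m Z ! k) (0\<^sub>m (s * m') (s * m)) (X' ! k)"
      using mat_tuples_nth[OF tX k] mat_tuples_nth[OF tX' k] k len by (simp add: tuple_upper_def)
  qed
  then have "tuple_upper X 1 Z X' \<in> nc_level d (fm_domain s d L A Y) (n + n')"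
    using nc_level_fm_domainI[of "m + m'"] m(1,2) m'(2) by (simp add: distrib_left)
  then show "\<exists>c. c \<noteq> 0 \<and> tuple_upper X c Z X' \<in> nc_level d (fm_domain s d L A Y) (n + n')"
    using one_neq_zero by blast
qed

text \<open>For m = 1 the Kronecker factor is trivial, so all shifted coordinates vanish at Y and
  \<Lambda> is the identity, of determinant 1.\<close>

lemma centre_in_fm_domain_at: "Y \<in> fm_domain_at s d L A Y 1"
proof -
  have "shift Y 1 Y k = 0\<^sub>m (s * 1) (s * 1)" if "k < d" for k
  proof -
    have "kron (1\<^sub>m 1) (Y ! k) = Y ! k"
      using Y_nth[OF that] by (intro eq_matI) (auto simp: kron_def)
    then show ?thesis using Y_nth[OF that] by (simp add: shift_def)
  qed
  then have "\<alpha> 1 Y = blockwise_sum s L L d A 1 1 (\<lambda>k. 0\<^sub>m (s * 1) (s * 1))"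
    by (rule blockwise_sum_cong)
  also have "\<dots> = 0\<^sub>m (L * 1) (L * 1)" by (rule blockwise_sum_zero[OF s A])
  finally have "fm_Lambda s d L A Y 1 Y = 1\<^sub>m L"
    unfolding fm_Lambda_eq by (intro eq_matI) auto
  then show ?thesis using Y by (simp add: fm_domain_at_def)
qed

lemma fm_function_carrier:
  assumes "X \<in> fm_domain_at s d L A Y m"
  shows "fm_function s d L D C A B Y X \<in> carrier_mat (s * m) (s * m)"
proof -
  have X: "X \<in> mat_tuples d (s * m) (s * m)" and det: "det (fm_Lambda s d L A Y m X) \<noteq> 0"
    using assms by (auto simp: fm_domain_at_def)
  show ?thesis
    unfolding fm_function_eq[OF X]
    by (rule add_carrier_mat[OF mult_carrier_mat[OF mult_carrier_mat[OF kron_one_carrier[OF C]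
      mat_inv(1)[OF fm_Lambda_carrier det]] blockwise_sum_carrier]])
qed

text \<open>Multiplying the conjugated tuple by T on the right cancels \<open>mat_inv T\<close> and
  gives the intertwining relation; its conclusion is then multiplied on the right by
  \<open>mat_inv T\<close>.\<close>

lemma fm_function_conj:
  assumes X: "X \<in> fm_domain_at s d L A Y m" and TX: "tuple_conj T X \<in> fm_domain_at s d L A Y m"
    and T: "T \<in> carrier_mat (s * m) (s * m)" "invertible_mat T"
  shows "fm_function s d L D C A B Y (tuple_conj T X) = T * fm_function s d L D C A B Y X * mat_inv T"
proof -
  note inv = mat_inv[OF T(1) det_nonzero_if_invertible_mat[OF T(2,1)]]
  have tX: "X \<in> mat_tuples d (s * m) (s * m)" using X by (simp add: fm_domain_at_def)
  have "T * X ! k = tuple_conj T X ! k * T" if k: "k < d" for k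
  proof -
    note Xk = mat_tuples_nth[OF tX k]
    note carrier = T(1) inv(1) Xk
    note dims = carrier[THEN carrier_matD(1)] carrier[THEN carrier_matD(2)]
    have "tuple_conj T X ! k = T * X ! k * mat_inv T"
      using tX k by (simp add: tuple_conj_def mat_tuples_def)
    then show ?thesis using Xk T(1) by (simp add: mult_assoc_dim dims inv(3))
  qed
  note TR = fm_function_intertwining[OF X TX T(1) this]
  show ?thesis
    using TR assoc_mult_mat[OF fm_function_carrier[OF TX] T(1) inv(1)] fm_function_carrier[OF TX]
    by (simp add: inv(2))
qed

lemma nc_function_fm_function: "nc_function d (fm_domain s d L A Y) (fm_function s d L D C A B Y)"
  unfolding nc_function_def
proof (intro conjI allI ballI impI)
  show "fm_function s d L D C A B Y X \<in> carrier_mat n n"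
    if "X \<in> nc_level d (fm_domain s d L A Y) n" for n X
    using that by (rule nc_level_fm_domainE) (simp add: fm_function_carrier)
  show "fm_function s d L D C A B Y (tuple_direct_sum X X') =
      direct_sum (fm_function s d L D C A B Y X) (fm_function s d L D C A B Y X')"
    if "X \<in> fm_domain s d L A Y" "X' \<in> fm_domain s d L A Y" for X X'
    using that by (auto simp: fm_domain_def intro: fm_function_direct_sum)
  fix n X T assume X: "X \<in> nc_level d (fm_domain s d L A Y) n" and T: "T \<in> carrier_mat n n" "invertible_mat T"
    and TX: "tuple_conj T X \<in> nc_level d (fm_domain s d L A Y) n"
  obtain m where m: "n = s * m" "X \<in> fm_domain_at s d L A Y m" using X by (rule nc_level_fm_domainE)
  obtain m' where m': "n = s * m'" "tuple_conj T X \<in> fm_domain_at s d L A Y m'"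
    using TX by (rule nc_level_fm_domainE)
  \<comment> \<open>Both memberships concern the same level n, and s \<ge> 1 can be cancelled; the
    intertwining property needs one common m.\<close>
  have "m' = m" using m(1) m'(1) s by simp
  then show "fm_function s d L D C A B Y (tuple_conj T X) = T * fm_function s d L D C A B Y X * mat_inv T"
    using m m' T by (intro fm_function_conj) auto
qed

end

theorem theorem2p6:
  fixes s d L :: nat
    and D C :: "'a::field mat"
    and A B :: "nat \<Rightarrow> 'a mat \<Rightarrow> 'a mat"
    and Y :: "'a mat list"
  assumes "s \<ge> 1" and "d \<ge> 1"
    and "fm_realization s d L D C A B Y"
    and "linearized_lost_abbey s d L D C A B Y"
  shows "nc_set d (fm_domain s d L A Y)
    \<and> upper_admissible d (fm_domain s d L A Y)
    \<and> Y \<in> fm_domain_at s d L A Y 1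
    \<and> nc_function d (fm_domain s d L A Y) (fm_function s d L D C A B Y)
    \<and> (\<forall>n. \<not> s dvd n \<longrightarrow> nc_level d (fm_domain s d L A Y) n = {})"
proof -
  interpret lost_abbey_realization s d L D C A B Y
    using assms by unfold_locales
  \<comment> \<open>Any point at level n would give n = s * m.\<close>
  have "nc_level d (fm_domain s d L A Y) n = {}" if "\<not> s dvd n" for n
    using that by (auto elim: nc_level_fm_domainE)
  then show ?thesis
    using nc_set_fm_domain upper_admissible_fm_domain centre_in_fm_domain_at nc_function_fm_function
    by blast
qed

end
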